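(* Let $\mathbb V$ be a $7$-dimensional real vector space and fix a $\mathrm G_2$-structure $\Phi\in\Lambda^3\mathbb V^*$. (1) Fix a nonzero vector $\mathbb S\in\mathbb V$, rescaled so that $\varepsilon:=-H_\Phi(\mathbb S,\mathbb S)\in\{-1,0,+1\}$. For any $(\bar A,B)\in\mathbb R^2$ such that $-\varepsilon\bar A^2+2\bar A+B^2=0$, the $3$-form $$\Phi':=\Phi+\bar A\,\Phi_I+B\,\Phi_J\in\Lambda^3\mathbb V^*$$ is a $\mathrm G_2$-structure compatible with the $\mathrm{SO}(3,4)$-structure $(H_\Phi,[\epsilon_\Phi])$, that is, $(H_{\Phi'},[\epsilon_{\Phi'}])=(H_\Phi,[\epsilon_\Phi])$. (2) Conversely, if a $\mathrm G_2$-structure $\Phi'$ on $\mathbb V$ satisfies $(H_{\Phi'},[\epsilon_{\Phi'}])=(H_\Phi,[\epsilon_\Phi])$, there are a vector $\mathbb S\in\mathbb V$ (which may be taken with $\varepsilon:=-H_\Phi(\mathbb S,\mathbb S)\in\{-1,0,+1\}$) and $(\bar A,B)\in\mathbb R^2$ satisfying $-\varepsilon\bar A^2+2\bar A+B^2=0$ such that $\Phi'=\Phi+\bar A\,\Phi_I+B\,\Phi_J$.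
   Context: A $\mathrm G_2$-structure (split form) on a $7$-dimensional real vector space $\mathbb V$ is a $3$-form $\Phi$ which, in some basis $(E_a)$ with dual basis $(e^a)$, equals $-e^{147}+\sqrt2\,e^{156}+\sqrt2\,e^{237}+e^{245}+e^{346}$ ($e^{abc}=e^a\wedge e^b\wedge e^c$). It determines, independently of the basis, the bilinear form $H_\Phi$ of signature $(3,4)$ with $H_\Phi(E_1,E_7)=H_\Phi(E_2,E_5)=H_\Phi(E_3,E_6)=1$, $H_\Phi(E_4,E_4)=-1$ and all other pairings of basis vectors zero, and the volume form $\epsilon_\Phi=-e^{1234567}$, with orientation $[\epsilon_\Phi]$ and Hodge star $*_\Phi$. The cross product is defined by $H_\Phi(x\times y,z)=\Phi(x,y,z)$, and $( *_\Phi\Phi)(x,y,z,w)=H_\Phi(x\times y,z\times w)-H_\Phi(x,z)H_\Phi(y,w)+H_\Phi(x,w)H_\Phi(y,z)$. For $\mathbb S\in\mathbb V$, with $\mathbb S^\flat=H_\Phi(\mathbb S,\cdot)$: $\Phi_I:=\mathbb S\lrcorner(\mathbb S^\flat\wedge\Phi)$, $\Phi_J:=\mathbb S\lrcorner( *_\Phi\Phi)$. *)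

theory Defs
  imports "HOL-Analysis.Analysis"
begin

text \<open>
  A form is a function on lists of vectors; a \<open>k\<close>-form is alternating multilinear on lists
  of length \<open>k\<close> and vanishes on lists of any other length, so that equality of \<open>k\<close>-forms is
  equality of functions.
\<close>

type_synonym 'v form = "'v list \<Rightarrow> real"

definition kform :: "nat \<Rightarrow> 'v::real_vector form \<Rightarrow> bool" where
  "kform k \<alpha> \<longleftrightarrow>
     (\<forall>xs. length xs \<noteq> k \<longrightarrow> \<alpha> xs = 0) \<and>
     (\<forall>xs i. length xs = k \<and> i < k \<longrightarrow> linear (\<lambda>v. \<alpha> (xs[i := v]))) \<and>
     (\<forall>xs i j. length xs = k \<and> i < j \<and> j < k \<and> xs ! i = xs ! j \<longrightarrow> \<alpha> xs = 0)"

definition one_form :: "('v \<Rightarrow> real) \<Rightarrow> 'v form" where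
  "one_form f xs = (case xs of [x] \<Rightarrow> f x | _ \<Rightarrow> 0)"

text \<open>
  The wedge product as a signed sum over shuffles: \<open>I\<close> is the set of positions fed to \<open>\<alpha>\<close>, the
  remaining ones are fed to \<open>\<beta>\<close>, and the sign is that of the resulting permutation. For a
  \<open>k\<close>-form and an \<open>l\<close>-form only the \<open>I\<close> with \<open>k\<close> elements contribute. The normalisation is
  the determinant convention: \<open>(e\<^sup>1 \<and> \<dots> \<and> e\<^sup>k)(E\<^sub>1, \<dots>, E\<^sub>k) = 1\<close>.
\<close>

definition wedge :: "'v form \<Rightarrow> 'v form \<Rightarrow> 'v form" (infixr "\<and>\<^sub>f" 70) where
  "(\<alpha> \<and>\<^sub>f \<beta>) xs =
     (\<Sum>I\<in>Pow {..<length xs}.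
        (-1) ^ card {(i, j). i \<in> I \<and> j \<in> {..<length xs} - I \<and> j < i}
        * \<alpha> (nths xs I) * \<beta> (nths xs (- I)))"

definition wedges :: "'v form list \<Rightarrow> 'v form" where
  "wedges \<alpha>s = foldr (\<and>\<^sub>f) \<alpha>s (\<lambda>xs. if xs = [] then 1 else 0)"

definition interior_product :: "'v \<Rightarrow> 'v form \<Rightarrow> 'v form" where
  "interior_product v \<alpha> xs = \<alpha> (v # xs)"

definition flat :: "('v \<Rightarrow> 'v \<Rightarrow> real) \<Rightarrow> 'v \<Rightarrow> 'v form" where
  "flat H v = one_form (H v)"

text \<open>
  The Hodge star on \<open>k\<close>-forms of a metric \<open>H\<close> with volume form \<open>\<omega>\<close>, i.e. the operator with
  \<open>\<alpha> \<and> *\<beta> = \<langle>\<alpha>, \<beta>\<rangle> \<omega>\<close> for all \<open>k\<close>-forms \<open>\<alpha>\<close>. The decomposable forms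
  \<open>\<alpha> = x\<^sub>1\<^sup>\<flat> \<and> \<dots> \<and> x\<^sub>k\<^sup>\<flat>\<close> span the \<open>k\<close>-forms, and on these the inner product induced
  by \<open>H\<close> is \<open>\<langle>\<alpha>, \<beta>\<rangle> = \<beta>(x\<^sub>1, \<dots>, x\<^sub>k)\<close>.
\<close>

definition hodge_star ::
    "('v::real_vector \<Rightarrow> 'v \<Rightarrow> real) \<Rightarrow> 'v form \<Rightarrow> nat \<Rightarrow> 'v form \<Rightarrow> 'v form" where
  "hodge_star H \<omega> k \<beta> =
     (THE \<gamma>. kform (dim (UNIV :: 'v set) - k) \<gamma> \<and>
        (\<forall>xs. length xs = k \<longrightarrow> wedges (map (flat H) xs) \<and>\<^sub>f \<gamma> = (\<lambda>ys. \<beta> xs * \<omega> ys)))"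

definition orientation :: "'v form \<Rightarrow> 'v form set" where
  "orientation \<omega> = {\<omega>'. \<exists>c>0. \<omega>' = (\<lambda>xs. c * \<omega> xs)}"

text \<open>Bases of a 7-dimensional space are indexed by \<open>1, \<dots>, 7\<close>.\<close>

definition is_basis7 :: "(nat \<Rightarrow> 'v::real_vector) \<Rightarrow> bool" where
  "is_basis7 E \<longleftrightarrow>
     inj_on E {1..7} \<and> independent (E ` {1..7}) \<and> span (E ` {1..7}) = UNIV"

definition dual_basis7 :: "(nat \<Rightarrow> 'v::real_vector) \<Rightarrow> nat \<Rightarrow> 'v form" where
  "dual_basis7 E a = one_form (\<lambda>v. representation (E ` {1..7}) v (E a))"

text \<open>\<open>ewedge E [a, b, c]\<close> is \<open>e\<^sup>a \<and> e\<^sup>b \<and> e\<^sup>c\<close>.\<close>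

definition ewedge :: "(nat \<Rightarrow> 'v::real_vector) \<Rightarrow> nat list \<Rightarrow> 'v form" where
  "ewedge E is = wedges (map (dual_basis7 E) is)"

definition adapted :: "(nat \<Rightarrow> 'v::real_vector) \<Rightarrow> 'v form \<Rightarrow> bool" where
  "adapted E \<Phi> \<longleftrightarrow> is_basis7 E \<and>
     \<Phi> = (\<lambda>xs. - ewedge E [1,4,7] xs + sqrt 2 * ewedge E [1,5,6] xs
               + sqrt 2 * ewedge E [2,3,7] xs + ewedge E [2,4,5] xs + ewedge E [3,4,6] xs)"

definition g2_structure :: "'v::real_vector form \<Rightarrow> bool" where
  "g2_structure \<Phi> \<longleftrightarrow> (\<exists>E. adapted E \<Phi>)"

definition model_gram :: "nat \<Rightarrow> nat \<Rightarrow> real" where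
  "model_gram a b =
     (if {a, b} \<in> {{1, 7}, {2, 5}, {3, 6}} then 1 else if a = 4 \<and> b = 4 then -1 else 0)"

text \<open>
  The metric and the volume form do not depend on the adapted basis; for \<open>\<Phi>\<close> that is not a
  \<open>G\<^sub>2\<close>-structure nothing is claimed about the two descriptions below.
\<close>

definition g2_metric :: "'v::real_vector form \<Rightarrow> 'v \<Rightarrow> 'v \<Rightarrow> real" where
  "g2_metric \<Phi> =
     (THE H. bilinear H \<and>
        (\<forall>E. adapted E \<Phi> \<longrightarrow> (\<forall>a\<in>{1..7}. \<forall>b\<in>{1..7}. H (E a) (E b) = model_gram a b)))"

definition g2_volume :: "'v::real_vector form \<Rightarrow> 'v form" where
  "g2_volume \<Phi> =
     (THE \<omega>. \<forall>E. adapted E \<Phi> \<longrightarrow> \<omega> = (\<lambda>xs. - ewedge E [1,2,3,4,5,6,7] xs))"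

definition g2_star :: "'v::real_vector form \<Rightarrow> nat \<Rightarrow> 'v form \<Rightarrow> 'v form" where
  "g2_star \<Phi> = hodge_star (g2_metric \<Phi>) (g2_volume \<Phi>)"

definition Phi_I :: "'v::real_vector form \<Rightarrow> 'v \<Rightarrow> 'v form" where
  "Phi_I \<Phi> S = interior_product S (flat (g2_metric \<Phi>) S \<and>\<^sub>f \<Phi>)"

definition Phi_J :: "'v::real_vector form \<Rightarrow> 'v \<Rightarrow> 'v form" where
  "Phi_J \<Phi> S = interior_product S (g2_star \<Phi> 3 \<Phi>)"

end

theory Submission
  imports Defs
begin

text \<open>
  An adapted basis yields a cross product, which makes \<open>\<real> \<oplus> V\<close> a Clifford module
  with \<open>x \<cdot> (r, v) = (- H(x, v), r x + x \<times> v)\<close>. Every nonnull spinor \<open>q\<close> defines a 3-form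
  \<open>\<Phi>\<^sub>q(a, b, c) = - \<langle>a \<cdot> b \<cdot> c \<cdot> q, q\<rangle> / \<langle>q, q\<rangle>\<close>; for \<open>q = (1, 0)\<close> this is \<open>\<Phi>\<close>, and for
  \<open>q = (r, l S)\<close> it is the deformation of \<open>\<Phi>\<close> with \<open>A = - 2 l\<^sup>2 / N\<close>, \<open>B = - 2 r l / N\<close>,
  \<open>N = r\<^sup>2 - \<epsilon> l\<^sup>2\<close>, which parametrises the conic rationally. The Clifford relations give
  \<open>\<Phi>\<^sub>q \<circ> R\<^sub>x = - \<Phi>\<^bsub>x \<cdot> q\<^esub>\<close> for the reflection \<open>R\<^sub>x\<close>. Hence each \<open>\<Phi>\<^sub>q\<close> is the pullback of
  \<open>\<Phi>\<close> under a product of two reflections, and conversely, because reflections generate the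
  orthogonal group, each pullback of \<open>\<Phi>\<close> under an isometry is some \<open>\<plusminus>\<Phi>\<^sub>q\<close>, the sign being the
  determinant. The metric is determined by \<open>\<Phi>\<close> because \<open>x \<noteq> 0\<close> is null iff \<open>x \<times> y = 0\<close> for
  some \<open>y\<close> independent of \<open>x\<close>, and the remaining scale is a cube root of \<open>1\<close>.
\<close>

subsection \<open>Forms on lists\<close>

abbreviation unit_form :: "'v form" where
  "unit_form \<equiv> \<lambda>xs. if xs = [] then 1 else 0"

text \<open>The grading involution: contraction with a vector is an antiderivation, and this is the
  sign that the left factor acquires when the vector passes on to the right factor.\<close>

definition grade_sign :: "'v form \<Rightarrow> 'v form" where
  "grade_sign \<alpha> xs = (-1) ^ length xs * \<alpha> xs"

text \<open>Prepares the recursion of the wedge product: a shuffle of \<open>x # xs\<close> hands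
  position 0 to the right or to the left factor, and what remains is a shuffle of \<open>xs\<close>
  shifted by one.\<close>

lemma Pow_Suc_split:
  "Pow {..<Suc n} = (\<lambda>K. Suc ` K) ` Pow {..<n} \<union> (\<lambda>K. insert 0 (Suc ` K)) ` Pow {..<n}"
proof -
  have "I \<in> (\<lambda>K. Suc ` K) ` Pow {..<n} \<union> (\<lambda>K. insert 0 (Suc ` K)) ` Pow {..<n}"
    if "I \<subseteq> {..<Suc n}" for I
  proof -
    have "I = (if 0 \<in> I then insert 0 (Suc ` {j. Suc j \<in> I}) else Suc ` {j. Suc j \<in> I})"
      by (auto simp: image_iff) (metis not0_implies_Suc)+
    moreover have "{j. Suc j \<in> I} \<in> Pow {..<n}" using that by auto
    ultimately show ?thesis by (auto split: if_splits)
  qed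
  then show ?thesis by (auto simp: lessThan_Suc_eq_insert_0)
qed

definition inversions :: "nat \<Rightarrow> nat set \<Rightarrow> (nat \<times> nat) set" where
  "inversions n I = {(i, j). i \<in> I \<and> j \<in> {..<n} - I \<and> j < i}"

lemma finite_inversions: "I \<subseteq> {..<n} \<Longrightarrow> finite (inversions n I)"
  by (rule finite_subset[of _ "{..<n} \<times> {..<n}"]) (auto simp: inversions_def)

text \<open>Position 0 goes to the right factor, so each of the \<open>card K\<close> positions of
  the left factor forms one new inversion with it.\<close>

lemma card_inversions_Suc:
  assumes "K \<subseteq> {..<n}"
  shows "card (inversions (Suc n) (Suc ` K)) = card (inversions n K) + card K"
proof -
  have "inversions (Suc n) (Suc ` K)
      = map_prod Suc Suc ` inversions n K \<union> (\<lambda>i. (Suc i, 0)) ` K"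
    by (auto simp: inversions_def lessThan_Suc_eq_insert_0 image_iff)
  moreover have "finite K" using assms finite_subset by blast
  moreover have "card (map_prod Suc Suc ` inversions n K) = card (inversions n K)"
    by (rule card_image) (auto simp: inj_on_def)
  ultimately show ?thesis
    using finite_inversions[OF assms]
    by (simp, subst card_Un_disjoint) (auto simp: card_image inj_on_def)
qed

lemma card_inversions_insert:
  assumes "K \<subseteq> {..<n}"
  shows "card (inversions (Suc n) (insert 0 (Suc ` K))) = card (inversions n K)"
proof -
  have "inversions (Suc n) (insert 0 (Suc ` K)) = map_prod Suc Suc ` inversions n K"
    by (auto simp: inversions_def lessThan_Suc_eq_insert_0 image_iff)
  moreover have "card (map_prod Suc Suc ` inversions n K) = card (inversions n K)"
    by (rule card_image) (auto simp: inj_on_def)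
  ultimately show ?thesis by simp
qed

lemma wedge_inversions:
  "(\<alpha> \<and>\<^sub>f \<beta>) xs =
     (\<Sum>I\<in>Pow {..<length xs}.
        (-1) ^ card (inversions (length xs) I) * \<alpha> (nths xs I) * \<beta> (nths xs (- I)))"
  by (simp add: wedge_def inversions_def)

lemma wedge_Nil: "(\<alpha> \<and>\<^sub>f \<beta>) [] = \<alpha> [] * \<beta> []"
  by (simp add: wedge_def)

text \<open>All further properties of \<open>\<and>\<^sub>f\<close> come from this recursion over the argument list.\<close>

lemma wedge_Cons:
  "(\<alpha> \<and>\<^sub>f \<beta>) (x # xs) =
     (interior_product x \<alpha> \<and>\<^sub>f \<beta>) xs + (grade_sign \<alpha> \<and>\<^sub>f interior_product x \<beta>) xs"
proof -
  let ?n = "length xs"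
  let ?F = "\<lambda>I. (-1) ^ card (inversions (Suc ?n) I) * \<alpha> (nths (x # xs) I) * \<beta> (nths (x # xs) (- I))"
  have inj: "inj_on (\<lambda>K. Suc ` K) (Pow {..<?n})" "inj_on (\<lambda>K. insert 0 (Suc ` K)) (Pow {..<?n})"
    by (intro inj_onI; blast dest: Suc_inject)+
  \<comment> \<open>The extra \<open>card K\<close> inversions become the number of arguments of the
    left factor, which is the exponent in \<open>grade_sign\<close>.\<close>
  have len: "length (nths xs K) = card K" if "K \<subseteq> {..<?n}" for K
  proof -
    have "{i. i < ?n \<and> i \<in> K} = K" using that by auto
    then show ?thesis by (simp add: length_nths)
  qed
  have c: "{j. j \<notin> K} = - K" for K :: "nat set" by auto
  have "(\<alpha> \<and>\<^sub>f \<beta>) (x # xs) = sum ?F (Pow {..<Suc ?n})"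
    by (simp add: wedge_inversions)
  also have "\<dots> = sum ?F ((\<lambda>K. Suc ` K) ` Pow {..<?n}) + sum ?F ((\<lambda>K. insert 0 (Suc ` K)) ` Pow {..<?n})"
    unfolding Pow_Suc_split by (rule sum.union_disjoint) auto
  also have "sum ?F ((\<lambda>K. Suc ` K) ` Pow {..<?n}) = (grade_sign \<alpha> \<and>\<^sub>f interior_product x \<beta>) xs"
    unfolding wedge_inversions
    by (subst sum.reindex[OF inj(1)], rule sum.cong)
      (auto simp: card_inversions_Suc nths_Cons len c grade_sign_def interior_product_def power_add
         inj_image_mem_iff)
  also have "sum ?F ((\<lambda>K. insert 0 (Suc ` K)) ` Pow {..<?n}) = (interior_product x \<alpha> \<and>\<^sub>f \<beta>) xs"
    unfolding wedge_inversions
    by (subst sum.reindex[OF inj(2)], rule sum.cong)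
      (auto simp: card_inversions_insert nths_Cons c interior_product_def inj_image_mem_iff)
  finally show ?thesis by simp
qed

lemma interior_product_wedge:
  "interior_product x (\<alpha> \<and>\<^sub>f \<beta>) =
     (\<lambda>xs. (interior_product x \<alpha> \<and>\<^sub>f \<beta>) xs + (grade_sign \<alpha> \<and>\<^sub>f interior_product x \<beta>) xs)"
  by (simp add: interior_product_def wedge_Cons fun_eq_iff)

lemma wedge_add_left: "((\<lambda>xs. \<alpha> xs + \<beta> xs) \<and>\<^sub>f \<gamma>) xs = (\<alpha> \<and>\<^sub>f \<gamma>) xs + (\<beta> \<and>\<^sub>f \<gamma>) xs"
  by (simp add: wedge_def algebra_simps sum.distrib)

lemma wedge_add_right: "(\<alpha> \<and>\<^sub>f (\<lambda>xs. \<beta> xs + \<gamma> xs)) xs = (\<alpha> \<and>\<^sub>f \<beta>) xs + (\<alpha> \<and>\<^sub>f \<gamma>) xs"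
  by (simp add: wedge_def algebra_simps sum.distrib)

lemma wedge_scale_left: "((\<lambda>xs. c * \<alpha> xs) \<and>\<^sub>f \<beta>) xs = c * (\<alpha> \<and>\<^sub>f \<beta>) xs"
  by (simp add: wedge_def sum_distrib_left algebra_simps)

lemma wedge_scale_right: "(\<alpha> \<and>\<^sub>f (\<lambda>xs. c * \<beta> xs)) xs = c * (\<alpha> \<and>\<^sub>f \<beta>) xs"
  by (simp add: wedge_def sum_distrib_left algebra_simps)

lemma wedge_zero_left: "((\<lambda>xs. 0) \<and>\<^sub>f \<beta>) xs = 0"
  by (simp add: wedge_def)

lemma wedge_zero_right: "(\<alpha> \<and>\<^sub>f (\<lambda>xs. 0)) xs = 0"
  by (simp add: wedge_def)

lemma grade_sign_wedge:
  fixes \<alpha> \<beta> :: "'v form"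
  shows "grade_sign (\<alpha> \<and>\<^sub>f \<beta>) = grade_sign \<alpha> \<and>\<^sub>f grade_sign \<beta>"
proof
  fix xs :: "'v list"
  have "length (nths xs I) + length (nths xs (- I)) = length xs" for I
  proof -
    have "card {i. i < length xs \<and> i \<in> I} + card {i. i < length xs \<and> i \<in> - I}
        = card ({i. i < length xs \<and> i \<in> I} \<union> {i. i < length xs \<and> i \<in> - I})"
      by (rule card_Un_disjoint[symmetric]) auto
    also have "{i. i < length xs \<and> i \<in> I} \<union> {i. i < length xs \<and> i \<in> - I} = {..<length xs}"
      by auto
    finally show ?thesis by (simp add: length_nths)
  qed
  then have "(-1::real) ^ length xs = (-1) ^ length (nths xs I) * (-1) ^ length (nths xs (- I))" for I
    by (metis power_add)
  then show "grade_sign (\<alpha> \<and>\<^sub>f \<beta>) xs = (grade_sign \<alpha> \<and>\<^sub>f grade_sign \<beta>) xs"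
    unfolding grade_sign_def wedge_def sum_distrib_left
    by (intro sum.cong refl) (simp add: ac_simps)
qed

text \<open>Holds for arbitrary functions on lists. \<open>wedge_Cons\<close> unfolds both sides
  into the same three terms, one for each factor that may receive the first vector;
  \<open>grade_sign_wedge\<close> matches the signs.\<close>

lemma wedge_assoc:
  fixes \<alpha> \<beta> \<gamma> :: "'v form"
  shows "(\<alpha> \<and>\<^sub>f \<beta>) \<and>\<^sub>f \<gamma> = \<alpha> \<and>\<^sub>f (\<beta> \<and>\<^sub>f \<gamma>)"
proof
  fix xs :: "'v list"
  show "((\<alpha> \<and>\<^sub>f \<beta>) \<and>\<^sub>f \<gamma>) xs = (\<alpha> \<and>\<^sub>f (\<beta> \<and>\<^sub>f \<gamma>)) xs"
    by (induction xs arbitrary: \<alpha> \<beta> \<gamma>)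
      (simp_all add: wedge_Nil wedge_Cons interior_product_wedge wedge_add_left wedge_add_right
        grade_sign_wedge)
qed

lemma unit_wedge:
  fixes \<gamma> :: "'v form"
  shows "unit_form \<and>\<^sub>f \<gamma> = \<gamma>"
proof
  fix xs :: "'v list"
  have "grade_sign unit_form = (unit_form :: 'v form)"
    "interior_product x unit_form = (\<lambda>xs. 0)" for x :: 'v
    by (auto simp: grade_sign_def interior_product_def)
  then show "(unit_form \<and>\<^sub>f \<gamma>) xs = \<gamma> xs"
    by (induction xs arbitrary: \<gamma>) (simp_all add: wedge_Nil wedge_Cons wedge_zero_left,
        simp add: interior_product_def)
qed

lemma one_form_wedge_Nil: "(one_form f \<and>\<^sub>f \<beta>) [] = 0"
  by (simp add: wedge_Nil one_form_def)

text \<open>Laplace expansion: a one-form contracts to a multiple of the unit, and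
  \<open>grade_sign\<close> negates it. Explicit values of wedge products are computed with this
  rule.\<close>

lemma one_form_wedge_Cons:
  "(one_form f \<and>\<^sub>f \<beta>) (x # xs) = f x * \<beta> xs - (one_form f \<and>\<^sub>f interior_product x \<beta>) xs"
proof -
  have "interior_product x (one_form f) = (\<lambda>xs. f x * unit_form xs)"
    by (auto simp: interior_product_def one_form_def split: list.split)
  moreover have "grade_sign (one_form f) = (\<lambda>xs. - 1 * one_form f xs)"
    by (auto simp: grade_sign_def one_form_def split: list.split)
  ultimately show ?thesis
    by (simp add: wedge_Cons wedge_scale_left[of "f x" unit_form] unit_wedge
        wedge_scale_left[of "-1" "one_form f", simplified])
qed

lemma interior_product_one_form_wedge:
  "interior_product x (one_form f \<and>\<^sub>f \<beta>)
     = (\<lambda>xs. f x * \<beta> xs - (one_form f \<and>\<^sub>f interior_product x \<beta>) xs)"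
  unfolding interior_product_def[of x "one_form f \<and>\<^sub>f \<beta>"] one_form_wedge_Cons ..

lemma one_form_wedge_eq_0:
  "(\<And>y. y \<in> set xs \<Longrightarrow> f y = 0) \<Longrightarrow> (one_form f \<and>\<^sub>f \<beta>) xs = 0"
  by (induction xs arbitrary: \<beta>) (simp_all add: one_form_wedge_Nil one_form_wedge_Cons)

lemma wedges_Cons: "wedges (\<alpha> # \<alpha>s) = \<alpha> \<and>\<^sub>f wedges \<alpha>s"
  by (simp add: wedges_def)

lemma wedges_Nil: "wedges [] = unit_form"
  by (simp add: wedges_def)

lemma wedge_map: "(\<alpha> \<and>\<^sub>f \<beta>) (map g xs) = ((\<lambda>ys. \<alpha> (map g ys)) \<and>\<^sub>f (\<lambda>ys. \<beta> (map g ys))) xs"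
  by (simp add: wedge_def nths_map)

lemma one_form_map: "one_form f (map g xs) = one_form (\<lambda>x. f (g x)) xs"
  by (auto simp: one_form_def split: list.split)

lemma wedges_one_form_map:
  "wedges (map (\<lambda>i. one_form (f i)) is) (map g xs) = wedges (map (\<lambda>i. one_form (\<lambda>x. f i (g x))) is) xs"
  by (induction "is" arbitrary: xs) (simp_all add: wedges_Nil wedges_Cons wedge_map one_form_map)

subsection \<open>Alternating forms\<close>

lemma kform_wrong_length: "kform k \<alpha> \<Longrightarrow> length xs \<noteq> k \<Longrightarrow> \<alpha> xs = 0"
  by (auto simp: kform_def)

lemma kform_linear: "kform k \<alpha> \<Longrightarrow> length xs = k \<Longrightarrow> i < k \<Longrightarrow> linear (\<lambda>v. \<alpha> (xs[i := v]))"
  by (auto simp: kform_def)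

lemma kform_repeat: "kform k \<alpha> \<Longrightarrow> length xs = k \<Longrightarrow> i < k \<Longrightarrow> j < k \<Longrightarrow> i \<noteq> j \<Longrightarrow> xs ! i = xs ! j \<Longrightarrow> \<alpha> xs = 0"
  unfolding kform_def by (metis linorder_neqE_nat)

lemma kform_add: "kform k \<alpha> \<Longrightarrow> kform k \<beta> \<Longrightarrow> kform k (\<lambda>xs. \<alpha> xs + \<beta> xs)"
  unfolding kform_def by (auto intro: linear_compose_add)

lemma linear_mult_const: "linear f \<Longrightarrow> linear (\<lambda>v. c * f v :: real)"
  using linear_compose_scale_right[of f c] by simp

lemma kform_scale: "kform k \<alpha> \<Longrightarrow> kform k (\<lambda>xs. c * \<alpha> xs)"
  unfolding kform_def by (auto intro: linear_mult_const)

lemma kform_diff: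
  assumes "kform k \<alpha>" "kform k \<beta>"
  shows "kform k (\<lambda>xs. \<alpha> xs - \<beta> xs)"
  using kform_add[OF assms(1) kform_scale[OF assms(2), of "-1"]] by simp

lemma kform_map:
  assumes "kform k \<alpha>" "linear g"
  shows "kform k (\<lambda>xs. \<alpha> (map g xs))"
  unfolding kform_def
proof (intro conjI allI impI)
  fix xs :: "'b list" and i
  assume "length xs = k \<and> i < k"
  then have "linear (\<lambda>v. \<alpha> ((map g xs)[i := v]))" using kform_linear[OF assms(1), of "map g xs"] by simp
  from linear_compose[OF assms(2) this] show "linear (\<lambda>v. \<alpha> (map g (xs[i := v])))"
    by (simp add: map_update o_def)
next
  fix xs :: "'b list" and i j
  assume "length xs = k \<and> i < j \<and> j < k \<and> xs ! i = xs ! j"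
  then show "\<alpha> (map g xs) = 0" using kform_repeat[OF assms(1), of "map g xs" i j] by simp
qed (use kform_wrong_length[OF assms(1)] in simp)

lemma kform_linear_Cons:
  assumes "kform k \<alpha>" shows "linear (\<lambda>x. \<alpha> (x # xs))"
proof (cases "Suc (length xs) = k")
  case True
  then show ?thesis using kform_linear[OF assms, of "undefined # xs" 0] by auto
next
  case False
  then have "(\<lambda>x. \<alpha> (x # xs)) = (\<lambda>x. 0)" using kform_wrong_length[OF assms] by auto
  then show ?thesis by (simp add: module_hom_zero)
qed

lemma kform_Cons_Cons_self: "kform k \<alpha> \<Longrightarrow> \<alpha> (x # x # xs) = 0"
  using kform_repeat[of k \<alpha> "x # x # xs" 0 1] kform_wrong_length[of k \<alpha> "x # x # xs"] by force

lemma kform_interior_product: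
  assumes "kform (Suc k) \<alpha>" shows "kform k (interior_product x \<alpha>)"
  unfolding kform_def interior_product_def
proof (intro conjI allI impI)
  fix xs :: "'a list" and i
  assume "length xs = k \<and> i < k"
  then show "linear (\<lambda>v. \<alpha> (x # xs[i := v]))" using kform_linear[OF assms, of "x # xs" "Suc i"] by simp
next
  fix xs :: "'a list" and i j
  assume "length xs = k \<and> i < j \<and> j < k \<and> xs ! i = xs ! j"
  then show "\<alpha> (x # xs) = 0" using kform_repeat[OF assms, of "x # xs" "Suc i" "Suc j"] by simp
qed (use kform_wrong_length[OF assms] in simp)

text \<open>Polarisation of the third assumption. It is stated without \<open>kform\<close> because
  \<open>kform_SucI\<close> needs it before the form is known to be alternating.\<close>

lemma alternating_swap:
  assumes "\<And>xs. linear (\<lambda>x. \<alpha> (x # xs))" "\<And>x xs. linear (\<lambda>y. \<alpha> (x # y # xs))"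
    and "\<And>x xs. \<alpha> (x # x # xs) = 0"
  shows "\<alpha> (x # y # xs) = - (\<alpha> (y # x # xs) :: real)"
proof -
  have "\<alpha> ((x + y) # (x + y) # xs) = \<alpha> (x # x # xs) + \<alpha> (x # y # xs) + \<alpha> (y # x # xs) + \<alpha> (y # y # xs)"
    using linear_add[OF assms(1)] linear_add[OF assms(2)] by simp
  then show ?thesis using assms(3) by simp
qed

lemma kform_swap: "kform k \<alpha> \<Longrightarrow> \<alpha> (x # y # xs) = - \<alpha> (y # x # xs)"
proof (cases k)
  case (Suc m)
  assume *: "kform k \<alpha>"
  show ?thesis
  proof (rule alternating_swap)
    show "linear (\<lambda>y. \<alpha> (x # y # xs))" for x xs
      using kform_linear_Cons[OF kform_interior_product, of m \<alpha> x xs] * Suc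
      by (simp add: interior_product_def)
  qed (use * kform_linear_Cons kform_Cons_Cons_self in blast)+
qed (simp add: kform_wrong_length)

text \<open>Reduces alternation to the first two arguments: a repetition behind the first argument
  is seen by a contraction, and one that involves the first argument is moved there by a
  swap.\<close>

lemma kform_SucI:
  assumes "\<alpha> [] = 0" "\<And>x. kform k (interior_product x \<alpha>)"
    "\<And>xs. linear (\<lambda>x. \<alpha> (x # xs))" "\<And>x xs. \<alpha> (x # x # xs) = 0"
  shows "kform (Suc k) \<alpha>"
  unfolding kform_def
proof (intro conjI allI impI)
  fix xs :: "'a list" assume "length xs \<noteq> Suc k"
  then show "\<alpha> xs = 0"
    using assms(1) kform_wrong_length[OF assms(2)] by (cases xs) (auto simp: interior_product_def)
next
  fix xs :: "'a list" and i
  assume *: "length xs = Suc k \<and> i < Suc k"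
  then obtain x ys where xs: "xs = x # ys" by (cases xs) auto
  show "linear (\<lambda>v. \<alpha> (xs[i := v]))"
  proof (cases i)
    case 0 then show ?thesis using assms(3) xs by simp
  next
    case (Suc m)
    then show ?thesis using kform_linear[OF assms(2), of ys m x] * xs by (simp add: interior_product_def)
  qed
next
  fix xs :: "'a list" and i j
  assume *: "length xs = Suc k \<and> i < j \<and> j < Suc k \<and> xs ! i = xs ! j"
  then have "2 \<le> length xs" by linarith
  then obtain x y ys where xs: "xs = x # y # ys" by (auto simp: numeral_2_eq_2 Suc_le_length_iff)
  have swap: "\<alpha> (x # y # ys) = - \<alpha> (y # x # ys)"
  proof (rule alternating_swap[of \<alpha>])
    show "linear (\<lambda>y. \<alpha> (x # y # xs))" for x xs
      using kform_linear_Cons[OF assms(2)] by (simp add: interior_product_def)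
  qed (rule assms)+
  consider "i = 0" "j = 1" | m where "i = 0" "j = Suc (Suc m)" | l m where "i = Suc l" "j = Suc m"
  proof (cases i)
    case 0
    then show ?thesis using that(1,2) * by (cases j; cases "j - 1") auto
  next
    case (Suc l)
    then show ?thesis using that(3) * by (cases j) auto
  qed
  then show "\<alpha> xs = 0"
  proof cases
    case 1
    then have "x = y" using * xs by auto
    then show ?thesis using xs assms(4) by blast
  next
    \<comment> \<open>After swapping the first two vectors, both copies of the repeated vector are
      arguments of the contraction with \<open>y\<close>.\<close>
    case 2
    then have "\<alpha> (y # x # ys) = 0"
      using kform_repeat[OF assms(2), of "x # ys" 0 "Suc m" y] * xs by (simp add: interior_product_def)
    then show ?thesis using swap xs by simp
  next
    case 3
    then show ?thesis
      using kform_repeat[OF assms(2), of "y # ys" l m x] * xs by (simp add: interior_product_def)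
  qed
qed

lemma kform_0I: "(\<And>x xs. \<alpha> (x # xs) = 0) \<Longrightarrow> kform 0 \<alpha>"
  unfolding kform_def by (metis length_0_conv less_nat_zero_code list.exhaust)

lemma wedge_right_linear:
  assumes "\<And>ys. linear (\<lambda>x. \<beta> x ys)"
  shows "linear (\<lambda>x. (\<alpha> \<and>\<^sub>f \<beta> x) xs)"
  unfolding wedge_def
  by (intro linear_compose_sum ballI linear_mult_const) (use assms in simp)

text \<open>Contraction with \<open>x\<close> gives \<open>f x\<close> times \<beta> minus the wedge
  of \<open>f\<close> with the contracted \<beta>, whose degree is lower by one, so
  \<open>kform_SucI\<close> carries an induction on the degree.\<close>

lemma kform_one_form_wedge:
  assumes f: "linear f" and \<beta>: "kform k \<beta>"
  shows "kform (Suc k) (one_form f \<and>\<^sub>f \<beta>)"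
  using \<beta>
proof (induction k arbitrary: \<beta>)
  have lin: "linear (\<lambda>x. (one_form f \<and>\<^sub>f \<beta>) (x # xs))" if "kform k \<beta>" for k \<beta> xs
    unfolding one_form_wedge_Cons
  proof (intro linear_compose_sub wedge_right_linear)
    show "linear (\<lambda>x. f x * \<beta> xs)" using linear_mult_const[OF f, of "\<beta> xs"] by (simp add: mult.commute)
    show "linear (\<lambda>x. interior_product x \<beta> ys)" for ys
      using kform_linear_Cons[OF that] by (simp add: interior_product_def)
  qed
  have alt: "(one_form f \<and>\<^sub>f \<beta>) (x # x # xs) = 0" if "kform k \<beta>" for k \<beta> x xs
  proof -
    have "interior_product x (interior_product x \<beta>) = (\<lambda>ys. 0)"
      using kform_Cons_Cons_self[OF that] by (auto simp: interior_product_def)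
    then show ?thesis by (simp add: one_form_wedge_Cons wedge_zero_right, simp add: interior_product_def)
  qed
  {
    case 0
    then have ip: "interior_product x \<beta> = (\<lambda>ys. 0)" for x
      by (auto simp: interior_product_def kform_wrong_length)
    show ?case
      by (rule kform_SucI[OF _ _ lin[OF 0] alt[OF 0]])
        (simp_all add: ip one_form_wedge_Nil interior_product_one_form_wedge wedge_zero_right kform_scale[OF 0])
  next
    case (Suc k)
    show ?case
      by (rule kform_SucI[OF _ _ lin[OF Suc(2)] alt[OF Suc(2)]])
       (simp_all add: one_form_wedge_Nil interior_product_one_form_wedge kform_diff kform_scale Suc kform_interior_product)
  }
qed

lemma kform_unit: "kform 0 unit_form"
  by (rule kform_0I) simp

lemma kform_wedges_one_forms:
  "(\<And>i. i \<in> set is \<Longrightarrow> linear (f i)) \<Longrightarrow> kform (length is) (wedges (map (\<lambda>i. one_form (f i)) is))"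
  by (induction "is") (simp_all add: wedges_Nil wedges_Cons kform_unit kform_one_form_wedge)

subsection \<open>Cross products and their spinors\<close>

text \<open>Cross products are axiomatised for a nondegenerate form of any signature, so that
  \<open>metric_unique\<close> can compare two of them on the same space.\<close>

locale cross_product =
  fixes H :: "'v::real_vector \<Rightarrow> 'v \<Rightarrow> real" and cr :: "'v \<Rightarrow> 'v \<Rightarrow> 'v"
  assumes bilinear_H: "bilinear H" and H_sym: "H x y = H y x"
    and nondegenerate: "(\<And>z. H x z = 0) \<Longrightarrow> x = 0"
    and bilinear_cr: "bilinear cr"
    and cr_self: "cr x x = 0" and H_cr_left: "H (cr x y) x = 0"
    and H_cr_cr_self: "H (cr x y) (cr x y) = H x x * H y y - (H x y)\<^sup>2"
begin

lemmas H_simps = bilinear_ladd[OF bilinear_H] bilinear_radd[OF bilinear_H]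
  bilinear_lsub[OF bilinear_H] bilinear_rsub[OF bilinear_H]
  bilinear_lmul[OF bilinear_H] bilinear_rmul[OF bilinear_H]
  bilinear_lneg[OF bilinear_H] bilinear_rneg[OF bilinear_H]
  bilinear_lzero[OF bilinear_H] bilinear_rzero[OF bilinear_H]

lemmas cr_simps = bilinear_ladd[OF bilinear_cr] bilinear_radd[OF bilinear_cr]
  bilinear_lsub[OF bilinear_cr] bilinear_rsub[OF bilinear_cr]
  bilinear_lmul[OF bilinear_cr] bilinear_rmul[OF bilinear_cr]
  bilinear_lneg[OF bilinear_cr] bilinear_rneg[OF bilinear_cr]
  bilinear_lzero[OF bilinear_cr] bilinear_rzero[OF bilinear_cr]

lemma nondegenerate_eq: "(\<And>z. H x z = H y z) \<Longrightarrow> x = y"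
  using nondegenerate[of "x - y"] by (simp add: H_simps)

lemma cr_anti: "cr x y = - cr y x"
  using cr_self[of "x + y"] cr_self[of x] cr_self[of y] by (simp add: cr_simps eq_neg_iff_add_eq_0 add.commute)

lemma H_cr_swap: "H (cr x y) z = - H (cr z y) x"
  using H_cr_left[of "x + z" y] by (simp add: H_simps cr_simps H_cr_left)

lemma H_cr_skew: "H (cr x y) z = - H (cr x z) y"
  by (metis H_cr_swap H_simps(7) cr_anti)

lemma H_cr_cycle: "H (cr x y) z = H (cr y z) x"
  by (metis H_cr_skew H_cr_swap minus_minus)

lemma H_cr_cr: "H (cr x y) (cr x z) = H x x * H y z - H x y * H x z"
proof -
  have "H (cr x (y + z)) (cr x (y + z)) = H x x * H (y + z) (y + z) - (H x (y + z))\<^sup>2"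
    by (rule H_cr_cr_self)
  then show ?thesis
    using H_cr_cr_self[of x y] H_cr_cr_self[of x z] H_sym[of z y] H_sym[of "cr x z" "cr x y"]
    by (simp add: H_simps cr_simps power2_eq_square algebra_simps)
qed

text \<open>\<open>cr x\<close> is skew for \<open>H\<close>, so the polarised norm identity
  \<open>H_cr_cr\<close> gives all pairings of \<open>cr x (cr x y)\<close>, and nondegeneracy does
  the rest.\<close>

lemma cr_cr: "cr x (cr x y) = H x y *\<^sub>R x - H x x *\<^sub>R y"
proof (rule nondegenerate_eq)
  fix z
  have "H (cr x (cr x y)) z = - H (cr x y) (cr x z)" using H_cr_skew H_sym by metis
  then show "H (cr x (cr x y)) z = H (H x y *\<^sub>R x - H x x *\<^sub>R y) z"
    by (simp add: H_simps H_cr_cr)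
qed

lemma cr_cr_polar:
  "cr x (cr y z) + cr y (cr x z) = H x z *\<^sub>R y + H y z *\<^sub>R x - (2 * H x y) *\<^sub>R z"
proof -
  have "cr (x + y) (cr (x + y) z) = H (x + y) z *\<^sub>R (x + y) - H (x + y) (x + y) *\<^sub>R z" by (rule cr_cr)
  then show ?thesis
    using cr_cr[of x z] cr_cr[of y z] H_sym[of y x] by (simp add: H_simps cr_simps algebra_simps)
qed

text \<open>The cross product formula for the Hodge dual of the 3-form;
  \<open>hodge_star_g2_form\<close> shows that it agrees with the star of the definition.\<close>

definition psi :: "'v \<Rightarrow> 'v \<Rightarrow> 'v \<Rightarrow> 'v \<Rightarrow> real" where
  "psi x y z w = H (cr x y) (cr z w) - H x z * H y w + H x w * H y z"

lemma psi_12: "psi x x z w = 0"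
  by (simp add: psi_def cr_self H_simps)

lemma psi_34: "psi x y z z = 0"
  by (simp add: psi_def cr_self H_simps)

lemma psi_23: "psi x y y w = 0"
  using H_cr_cr[of y x w] H_sym[of y x] cr_anti[of x y] by (simp add: psi_def H_simps)

text \<open>Polarising \<open>psi_34\<close> and \<open>psi_23\<close> gives the neighbouring
  transpositions, and the transposition of places 2 and 4 is a product of three of these.\<close>

lemma psi_swap_24: "psi x y z w = - psi x w z y"
proof -
  have sw: "psi x y z w = - psi x y w z" "psi x y z w = - psi x z y w" for x y z w
    using psi_34[of x y "z + w"] psi_34[of x y z] psi_34[of x y w]
      psi_23[of x "y + z" w] psi_23[of x y w] psi_23[of x z w]
    by (simp_all add: psi_def H_simps cr_simps algebra_simps)
  show ?thesis using sw(1)[of x y z w] sw(2)[of x y w z] sw(1)[of x w y z] by simp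
qed

section \<open>The Clifford action on spinors and the 3-form of a spinor\<close>

definition cliff :: "'v \<Rightarrow> real \<times> 'v \<Rightarrow> real \<times> 'v" where
  "cliff x q = (- H x (snd q), fst q *\<^sub>R x + cr x (snd q))"

definition spinor_ip :: "real \<times> 'v \<Rightarrow> real \<times> 'v \<Rightarrow> real" where
  "spinor_ip p q = fst p * fst q + H (snd p) (snd q)"

lemma cliff_anticommute: "cliff x (cliff y q) + cliff y (cliff x q) = (- 2 * H x y) *\<^sub>R q"
proof -
  have "cr x (cr y v) + cr y (cr x v) = H x v *\<^sub>R y + H y v *\<^sub>R x - (2 * H x y) *\<^sub>R v" for v
    by (rule cr_cr_polar)
  moreover have "H x (cr y v) + H y (cr x v) = 0" for v
    using H_cr_swap[of x v y] H_sym cr_anti H_cr_skew by (metis add.right_inverse H_cr_cycle)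
  ultimately show ?thesis
    using H_sym[of y x] cr_anti[of y x]
    by (cases q) (simp add: cliff_def H_simps cr_simps algebra_simps)
qed

lemma cliff_cliff: "cliff x (cliff x q) = (- H x x) *\<^sub>R q"
proof -
  have "2 *\<^sub>R cliff x (cliff x q) = 2 *\<^sub>R ((- H x x) *\<^sub>R q)"
    using cliff_anticommute[of x x q] by (simp add: scaleR_2)
  then show ?thesis by (simp only: scaleR_cancel_left) simp
qed

lemma cliff_simps: "cliff (x + y) q = cliff x q + cliff y q" "cliff (c *\<^sub>R x) q = c *\<^sub>R cliff x q"
  "cliff (- x) q = - cliff x q" "cliff (x - y) q = cliff x q - cliff y q"
  "cliff x (p + q) = cliff x p + cliff x q" "cliff x (c *\<^sub>R p) = c *\<^sub>R cliff x p"
  "cliff x (- p) = - cliff x p" "cliff x (p - q) = cliff x p - cliff x q"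
  by (simp_all add: cliff_def H_simps cr_simps algebra_simps prod_eq_iff)

lemma ip_simps: "spinor_ip (p + p') q = spinor_ip p q + spinor_ip p' q"
  "spinor_ip (c *\<^sub>R p) q = c * spinor_ip p q" "spinor_ip (- p) q = - spinor_ip p q"
  by (simp_all add: spinor_ip_def H_simps algebra_simps)

lemma ip_sym: "spinor_ip p q = spinor_ip q p"
  by (simp add: spinor_ip_def H_sym mult.commute)

lemma cliff_skew: "spinor_ip (cliff x p) q = - spinor_ip p (cliff x q)"
proof -
  have "H (cr x v) w = - H v (cr x w)" for v w using H_cr_skew H_sym by metis
  then show ?thesis
    using H_sym[of x] by (simp add: spinor_ip_def cliff_def H_simps algebra_simps)
qed

text \<open>In particular a nonnull vector takes nonnull spinors to nonnull spinors.\<close>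

lemma ip_cliff_cliff: "spinor_ip (cliff x q) (cliff x q) = H x x * spinor_ip q q"
  using cliff_skew[of x q "cliff x q"] ip_sym[of q "cliff x (cliff x q)"]
  by (simp add: cliff_cliff ip_simps)

definition spin_form :: "real \<times> 'v \<Rightarrow> 'v \<Rightarrow> 'v \<Rightarrow> 'v \<Rightarrow> real" where
  "spin_form q a b c = - spinor_ip (cliff a (cliff b (cliff c q))) q / spinor_ip q q"

definition reflect :: "'v \<Rightarrow> 'v \<Rightarrow> 'v" where
  "reflect x y = y - (2 * H x y / H x x) *\<^sub>R x"

lemma cliff_reflect:
  assumes "H x x \<noteq> 0" shows "cliff x (cliff a p) = - cliff (reflect x a) (cliff x p)"
proof -
  have "cliff x (cliff a p) = (- 2 * H x a) *\<^sub>R p - cliff a (cliff x p)"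
    using cliff_anticommute[of x a p] by (simp add: eq_diff_eq)
  then show ?thesis
    using assms by (simp add: reflect_def cliff_simps cliff_cliff)
qed

text \<open>Moving \<open>x\<close> past \<open>a\<close>, \<open>b\<close>, \<open>c\<close> costs
  three signs and reflects each of them; then \<open>x\<close> meets the second \<open>x\<close>,
  and \<open>cliff_cliff\<close> leaves a scalar that cancels against the norm of
  \<open>cliff x q\<close>.\<close>

lemma spin_form_reflect:
  assumes x: "H x x \<noteq> 0"
  shows "spin_form q (reflect x a) (reflect x b) (reflect x c) = - spin_form (cliff x q) a b c"
proof -
  let ?X = "cliff (reflect x a) (cliff (reflect x b) (cliff (reflect x c) q))"
  have "cliff x (cliff a (cliff b (cliff c (cliff x q)))) = H x x *\<^sub>R ?X"
    by (simp add: cliff_reflect[OF x] cliff_simps cliff_cliff)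
  then have "spinor_ip (cliff a (cliff b (cliff c (cliff x q)))) (cliff x q) = - H x x * spinor_ip ?X q"
    using cliff_skew[of x "cliff a (cliff b (cliff c (cliff x q)))" q] by (simp add: ip_simps)
  then show ?thesis using x by (simp add: spin_form_def ip_cliff_cliff)
qed

lemma spin_form_one: "spin_form (1, 0) a b c = H (cr a b) c"
  using H_cr_cycle[of a b c] H_sym[of a]
  by (simp add: spin_form_def spinor_ip_def cliff_def H_simps cr_simps)

text \<open>The bracket is the value of \<open>Phi_I\<close> in direction \<open>v\<close>, and
  \<open>psi v\<close> is that of \<open>Phi_J\<close> (see \<open>Phi_I_eq\<close>,
  \<open>Phi_J_eq\<close>), so spinor forms are deformations of the original 3-form.\<close>

lemma spin_form_expand:
  assumes "spinor_ip (r, v) (r, v) \<noteq> 0"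
  shows "spin_form (r, v) a b c = H (cr a b) c
    - 2 / spinor_ip (r, v) (r, v) *
        (H v v * H (cr a b) c - H v a * H (cr v b) c + H v b * H (cr v a) c - H v c * H (cr v a) b)
    - 2 * r / spinor_ip (r, v) (r, v) * psi v a b c"
proof -
  define N where "N = spinor_ip (r, v) (r, v)"
  have N: "N = r\<^sup>2 + H v v" "N \<noteq> 0"
    using assms by (simp_all add: N_def spinor_ip_def power2_eq_square)
  \<comment> \<open>Skewness moves one Clifford factor to the other side, so that at most two of
    them are nested.\<close>
  have "- spinor_ip (cliff a (cliff b (cliff c (r, v)))) (r, v)
      = spinor_ip (cliff b (cliff c (r, v))) (cliff a (r, v))"
    using cliff_skew by simp
  also have "\<dots> = H a v * (r * H b c + H b (cr c v))
      + r * (r * H (cr b c) a - H c v * H b a + H (cr b (cr c v)) a)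
      - H c v * H b (cr a v) + r * H (cr b c) (cr a v) + H (cr b (cr c v)) (cr a v)"
    by (simp add: spinor_ip_def cliff_def H_simps cr_simps algebra_simps)
  finally have e: "- spinor_ip (cliff a (cliff b (cliff c (r, v)))) (r, v) = \<dots>" .
  have 1: "H (cr b c) (cr a v) = - psi v a b c - H v b * H a c + H v c * H a b"
    using cr_anti[of a v] H_sym[of "cr b c"] by (simp add: psi_def H_simps)
  have "H (cr b (cr c v)) a = H (cr v c) (cr b a)"
    using H_cr_skew[of b "cr c v" a] H_sym[of "cr b a"] cr_anti[of c v] by (simp add: H_simps)
  then have 2: "H (cr b (cr c v)) a = - psi v a b c + H v b * H a c - H v a * H b c"
    using psi_swap_24[of v c b a] H_sym[of c] by (simp add: psi_def)
  \<comment> \<open>The two occurrences of \<open>v\<close> are brought together by moving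
    \<open>v\<close> past \<open>b\<close>; then \<open>H_cr_cr\<close> evaluates the
    product.\<close>
  have "cr b (cr v a) = - cr v (cr b a) + H b a *\<^sub>R v + H v a *\<^sub>R b - (2 * H b v) *\<^sub>R a"
    using cr_cr_polar[of b v a] by (simp add: algebra_simps eq_diff_eq)
  moreover have "H (cr b (cr c v)) (cr a v) = H (cr c v) (cr b (cr v a))"
    using H_cr_skew[of b "cr c v" "cr a v"] H_sym[of "cr b (cr a v)"] cr_anti[of a v]
    by (simp add: H_simps cr_simps)
  moreover have "H (cr c v) (cr v (cr b a)) = - (H v v * H c (cr b a) - H v c * H v (cr b a))"
    using H_cr_cr[of v c "cr b a"] cr_anti[of c v] by (simp add: H_simps)
  moreover have "H (cr c v) v = 0" using H_cr_left[of v c] cr_anti[of c v] by (simp add: H_simps)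
  ultimately have 3: "H (cr b (cr c v)) (cr a v)
      = H v v * H c (cr b a) - H v c * H v (cr b a) + H v a * H (cr c v) b - 2 * H b v * H (cr c v) a"
    by (simp add: H_simps)
  have P: "H (cr b c) a = H (cr a b) c" "H b (cr c v) = H (cr v b) c" "H b (cr a v) = H (cr v b) a"
    "H c (cr b a) = - H (cr a b) c" "H v (cr b a) = H (cr v b) a" "H (cr c v) b = H (cr v b) c"
    "H (cr c v) a = H (cr v a) c" "H (cr v b) a = - H (cr v a) b"
    using H_cr_cycle H_sym H_cr_skew H_cr_swap cr_anti H_simps(7) by metis+
  have "- spinor_ip (cliff a (cliff b (cliff c (r, v)))) (r, v) = N * H (cr a b) c
     - 2 * (H v v * H (cr a b) c - H v a * H (cr v b) c + H v b * H (cr v a) c - H v c * H (cr v a) b)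
     - 2 * r * psi v a b c"
    unfolding e 1 2 3 P N
    using H_sym[of a v] H_sym[of c v] H_sym[of b v] H_sym[of b a]
    by (simp add: power2_eq_square algebra_simps)
  then show ?thesis
    using N(2) unfolding spin_form_def N_def[symmetric] by (simp add: divide_simps)
qed

subsection \<open>Reflections generate the orthogonal group\<close>

definition orthogonal_map :: "('v \<Rightarrow> 'v) \<Rightarrow> bool" where
  "orthogonal_map g \<longleftrightarrow> linear g \<and> (\<forall>x y. H (g x) (g y) = H x y)"

inductive reflect_gen :: "('v \<Rightarrow> 'v) \<Rightarrow> bool" where
  reflect_gen_id: "reflect_gen (\<lambda>y. y)"
| reflect_gen_reflect: "H x x \<noteq> 0 \<Longrightarrow> reflect_gen g \<Longrightarrow> reflect_gen (\<lambda>y. reflect x (g y))"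

lemma linear_reflect: "linear (reflect x)"
  by (rule linearI) (simp_all add: reflect_def H_simps algebra_simps add_divide_distrib)

lemma reflect_reflect: "H x x \<noteq> 0 \<Longrightarrow> reflect x (reflect x y) = y"
  by (simp add: reflect_def H_simps algebra_simps)

lemma orthogonal_reflect: "H x x \<noteq> 0 \<Longrightarrow> orthogonal_map (reflect x)"
  using H_sym by (simp add: orthogonal_map_def linear_reflect) (simp add: reflect_def H_simps field_simps)

lemma reflect_fixes: "H x y = 0 \<Longrightarrow> reflect x y = y"
  by (simp add: reflect_def)

lemma reflect_diff:
  assumes "H (f - e) (f - e) \<noteq> 0" "H e e = H f f"
  shows "reflect (f - e) f = e"
proof -
  have "2 * H (f - e) f = H (f - e) (f - e)"
    using assms(2) H_sym[of e f] by (simp add: H_simps)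
  then show ?thesis using assms(1) by (simp add: reflect_def)
qed

text \<open>A weak Cartan-Dieudonne theorem by induction along an orthogonal list of nonnull
  vectors: one or two reflections bring the image \<open>f\<close> of the next vector
  \<open>e\<close> back to \<open>e\<close>. Their axes are orthogonal to \<open>A\<close>, so what
  is already fixed stays fixed.\<close>

lemma reflect_gen_if_fixes:
  assumes "orthogonal_map g" "\<And>a. a \<in> A \<Longrightarrow> g a = a"
    and "\<And>u. u \<in> set us \<Longrightarrow> H u u \<noteq> 0" "sorted_wrt (\<lambda>u w. H u w = 0) us"
    and "\<And>u a. u \<in> set us \<Longrightarrow> a \<in> A \<Longrightarrow> H u a = 0" "span (set us \<union> A) = UNIV"
  shows "reflect_gen g"
  using assms
proof (induction us arbitrary: A g)
  case Nil
  have "g = (\<lambda>y. y)"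
  proof
    fix x
    show "g x = x"
      by (rule linear_eq_on_span[of g "\<lambda>y. y" A]) (use Nil in \<open>auto simp: orthogonal_map_def linear_ident\<close>)
  qed
  then show ?case by (simp add: reflect_gen_id)
next
  case (Cons e us)
  \<comment> \<open>A map that also fixes \<open>e\<close> falls under the induction hypothesis,
    with \<open>e\<close> moved into \<open>A\<close>.\<close>
  have step: "reflect_gen h" if h: "orthogonal_map h" "h e = e" "\<And>a. a \<in> A \<Longrightarrow> h a = a" for h
  proof (rule Cons.IH[OF h(1), of "insert e A"])
    show "H u a = 0" if "u \<in> set us" "a \<in> insert e A" for u a
      using that Cons.prems(4,5) H_sym[of u e] by auto
  qed (use h Cons.prems in auto)
  have comp: "orthogonal_map (\<lambda>y. reflect x (h y))" if "H x x \<noteq> 0" "orthogonal_map h" for x h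
    using that orthogonal_reflect[OF that(1)] linear_compose[of h "reflect x"]
    by (auto simp: orthogonal_map_def o_def)
  define f where "f = g e"
  have f: "H f f = H e e" using Cons.prems(1) by (simp add: orthogonal_map_def f_def)
  have ortho: "H f a = 0" "H e a = 0" if "a \<in> A" for a
  proof -
    show "H e a = 0" using that Cons.prems(5) by simp
    moreover have "H (g e) (g a) = H e a" using Cons.prems(1) by (simp add: orthogonal_map_def)
    ultimately show "H f a = 0" using Cons.prems(2)[OF that] by (simp add: f_def)
  qed
  have e: "H e e \<noteq> 0" using Cons.prems(3) by simp
  show ?case
  proof (cases "H (f - e) (f - e) = 0")
    case False
    have "reflect_gen (\<lambda>y. reflect (f - e) (g y))"
    proof (rule step)
      show "reflect (f - e) (g e) = e" using reflect_diff[OF False] f by (simp add: f_def)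
      show "reflect (f - e) (g a) = a" if "a \<in> A" for a
        using ortho[OF that] Cons.prems(2)[OF that] by (simp add: reflect_fixes H_simps)
    qed (rule comp[OF False Cons.prems(1)])
    from reflect_gen_reflect[OF False this] show ?thesis by (simp add: reflect_reflect[OF False])
  next
    case True
    \<comment> \<open>Parallelogram law: since \<open>e\<close> is nonnull, \<open>f + e\<close> and
      \<open>f - e\<close> are not both null. Reflection in \<open>f + e\<close> takes
      \<open>f\<close> to \<open>- e\<close>, and reflection in \<open>e\<close> then repairs the
      sign.\<close>
    have "H (f + e) (f + e) + H (f - e) (f - e) = 4 * H e e" using f by (simp add: H_simps)
    then have nz: "H (f + e) (f + e) \<noteq> 0" using True e by simp
    let ?h = "\<lambda>y. reflect e (reflect (f + e) (g y))"
    have "reflect_gen ?h"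
    proof (rule step)
      have "reflect (f + e) f = - e" using reflect_diff[of f "- e"] nz f by (simp add: H_simps)
      then show "?h e = e" using e by (simp add: f_def reflect_def H_simps scaleR_2)
      show "?h a = a" if "a \<in> A" for a
        using ortho[OF that] Cons.prems(2)[OF that] by (simp add: reflect_fixes H_simps)
    qed (intro comp nz e Cons.prems(1))
    from reflect_gen_reflect[OF nz reflect_gen_reflect[OF e this]] show ?thesis
      by (simp add: reflect_reflect[OF e] reflect_reflect[OF nz])
  qed
qed

subsection \<open>Null vectors\<close>

lemma not_UNIV_subset_span:
  assumes "finite (W :: 'v set)" "card W < dim (UNIV :: 'v set)"
  shows "\<not> UNIV \<subseteq> span W"
  using assms span_card_ge_dim[of W UNIV] by auto

lemma exists_pairing_one: "x \<noteq> 0 \<Longrightarrow> \<exists>w. H x w = 1"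
proof -
  assume "x \<noteq> 0"
  then obtain z where "H x z \<noteq> 0" using nondegenerate by blast
  then have "H x ((1 / H x z) *\<^sub>R z) = 1" by (simp add: H_simps)
  then show ?thesis by blast
qed

text \<open>For null \<open>x\<close>, \<open>cr x\<close> squares to 0 on the orthogonal complement
  of \<open>x\<close>. For \<open>z\<close> there, either \<open>cr x z\<close> is off the line of
  \<open>x\<close> and is killed, or it equals \<open>k *\<^sub>R x\<close> and
  \<open>z - k *\<^sub>R u\<close> is killed, where \<open>cr x u = x\<close>.\<close>

lemma null_annihilates:
  assumes dim: "dim (UNIV :: 'v set) > 3" and x: "H x x = 0" "x \<noteq> 0"
  obtains y where "y \<notin> span {x}" "cr x y = 0"
proof -
  obtain w where w: "H x w = 1" using exists_pairing_one[OF x(2)] by blast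
  define u where "u = cr x w"
  have u: "cr x u = x" using cr_cr[of x w] w x by (simp add: u_def)
  \<comment> \<open>Otherwise \<open>x\<close>, \<open>u\<close> and \<open>w\<close> would span the
    space, as \<open>w\<close> spans a complement of the hyperplane orthogonal to
    \<open>x\<close>.\<close>
  have "\<exists>z. H x z = 0 \<and> z \<notin> span {x, u}"
  proof (rule ccontr)
    assume "\<not> ?thesis"
    then have *: "z \<in> span {x, u}" if "H x z = 0" for z using that by blast
    have "z \<in> span {x, u, w}" for z
    proof -
      have "z - H x z *\<^sub>R w \<in> span {x, u}" by (rule *) (simp add: H_simps w)
      then have "z - H x z *\<^sub>R w \<in> span {x, u, w}" using span_mono[of "{x, u}" "{x, u, w}"] by blast
      moreover have "H x z *\<^sub>R w \<in> span {x, u, w}" by (intro span_scale span_base) simp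
      ultimately show ?thesis using span_add by fastforce
    qed
    moreover have "card {x, u, w} < dim (UNIV :: 'v set)"
      using card_length[of "[x, u, w]"] dim by simp
    ultimately show False using not_UNIV_subset_span[of "{x, u, w}"] by blast
  qed
  then obtain z where z: "H x z = 0" "z \<notin> span {x, u}" by blast
  have zx: "cr x (cr x z) = 0" using cr_cr[of x z] x z by simp
  show thesis
  proof (cases "cr x z \<in> span {x}")
    case False
    then show ?thesis using that zx by blast
  next
    case True
    then obtain k where k: "cr x z = k *\<^sub>R x" by (auto simp: span_singleton)
    show ?thesis
    proof (rule that)
      show "cr x (z - k *\<^sub>R u) = 0" by (simp add: cr_simps u k)
      show "z - k *\<^sub>R u \<notin> span {x}"
      proof
        assume "z - k *\<^sub>R u \<in> span {x}"
        then have "z - k *\<^sub>R u \<in> span {x, u}" using span_mono[of "{x}" "{x, u}"] by blast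
        moreover have "k *\<^sub>R u \<in> span {x, u}" by (intro span_scale span_base) simp
        ultimately show False using z(2) span_add by fastforce
      qed
    qed
  qed
qed

lemma annihilated_null:
  assumes "cr x y = 0" "y \<notin> span {x}" shows "H x x = 0"
proof (rule ccontr)
  assume nz: "H x x \<noteq> 0"
  have "H x x *\<^sub>R y = H x y *\<^sub>R x" using cr_cr[of x y] assms(1) by (simp add: cr_simps)
  then have "y = (H x y / H x x) *\<^sub>R x"
    using nz by (metis divide_inverse_commute eq_vector_fraction_iff)
  then show False using assms(2) by (metis span_base span_scale singletonI)
qed

text \<open>Supplies a reflection for \<open>g2_structure_spin_form\<close>. If the complement of
  \<open>S\<close> were totally isotropic, each vector would differ from a combination of
  \<open>S\<close> and \<open>w\<close> by a vector orthogonal to everything, so the dimension would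
  be at most 2.\<close>

lemma exists_nonnull_orthogonal:
  assumes dim: "dim (UNIV :: 'v set) > 2" and S: "S \<noteq> 0"
  shows "\<exists>x. H x S = 0 \<and> H x x \<noteq> 0"
proof (rule ccontr)
  assume "\<not> ?thesis"
  then have iso: "H x x = 0" if "H x S = 0" for x using that by blast
  have isot: "H x y = 0" if "H x S = 0" "H y S = 0" for x y
    using iso[of "x + y"] iso[of x] iso[of y] that H_sym[of y x] by (simp add: H_simps)
  obtain w where w: "H S w = 1" using exists_pairing_one[OF S] by blast
  have "z \<in> span {S, w}" for z
  proof (cases "H S S = 0")
    case False
    let ?d = "z - (H z S / H S S) *\<^sub>R S"
    have d: "H ?d S = 0" using False by (simp add: H_simps)
    have "?d = 0"
    proof (rule nondegenerate)
      fix t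
      have "H (t - (H t S / H S S) *\<^sub>R S) S = 0" using False by (simp add: H_simps)
      from isot[OF d this] show "H ?d t = 0" using d by (simp add: H_simps)
    qed
    then have "z = (H z S / H S S) *\<^sub>R S" by simp
    then show ?thesis by (metis span_base span_scale insertI1)
  next
    case True
    let ?e = "z - H z S *\<^sub>R w"
    let ?d = "?e - H ?e w *\<^sub>R S"
    have e: "H ?e S = 0" using w H_sym[of w S] by (simp add: H_simps)
    then have d: "H ?d S = 0" "H ?d w = 0" using True w by (simp_all add: H_simps)
    have "?d = 0"
    proof (rule nondegenerate)
      fix t
      have "H (t - H t S *\<^sub>R w) S = 0" using w H_sym[of w S] by (simp add: H_simps)
      from isot[OF d(1) this] show "H ?d t = 0" using d by (simp add: H_simps)
    qed
    then have "z = H ?e w *\<^sub>R S + H z S *\<^sub>R w" by (simp add: algebra_simps)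
    then show ?thesis by (metis span_add span_base span_scale insertI1 insertI2)
  qed
  moreover have "card {S, w} < dim (UNIV :: 'v set)"
    using card_length[of "[S, w]"] dim by simp
  ultimately show False using not_UNIV_subset_span[of "{S, w}"] by blast
qed

text \<open>Null vectors of \<open>H\<close> are recognised by the cross product, hence are null for
  \<open>H'\<close>. A hyperbolic pair \<open>p\<close>, \<open>q\<close> turns this into
  \<open>H' = l H\<close>; then \<open>cr = l cr'\<close>, and the double cross product forces
  \<open>l ^ 3 = 1\<close>.\<close>

lemma metric_unique:
  assumes "cross_product H' cr'" and eq: "\<And>x y z. H (cr x y) z = H' (cr' x y) z"
    and dim: "dim (UNIV :: 'v set) > 3" and p: "H p p = 0" "H q q = 0" "H p q = 1"
  shows "H' = H"
proof -
  interpret C: cross_product H' cr' by fact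
  have null: "H' x x = 0" if x: "H x x = 0" for x
  proof (cases "x = 0")
    case False
    obtain y where y: "y \<notin> span {x}" "cr x y = 0" using null_annihilates[OF dim x False] .
    have "cr' x y = 0" using eq[of x y] y by (intro C.nondegenerate) (simp add: H_simps)
    then show ?thesis using C.annihilated_null y by blast
  qed (simp add: C.H_simps)
  define l where "l = H' p q"
  have pq: "H' p p = 0" "H' q q = 0" using null p by auto
  have main: "H' z z = l * H z z \<and> H' p z = 0 \<and> H' q z = 0" if z: "H p z = 0" "H q z = 0" for z
  proof -
    \<comment> \<open>The vector \<open>?v\<close> below is \<open>H\<close>-null for each
      \<open>t\<close>. Its \<open>H'\<close>-norm is thus a polynomial in \<open>t\<close> that
      vanishes identically; the values at 1, -1 and 2 separate the coefficients.\<close>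
    have nul: "- H z z * t\<^sup>2 * l + t\<^sup>2 * H' z z + 2 * t * H' p z - t * t\<^sup>2 * H z z * H' q z = 0" for t
    proof -
      let ?v = "p - (t\<^sup>2 * H z z / 2) *\<^sub>R q + t *\<^sub>R z"
      have "H ?v ?v = 0" using p z H_sym[of z p] H_sym[of z q] H_sym[of q p] by (simp add: H_simps power2_eq_square)
      from null[OF this] show ?thesis
        using pq C.H_sym[of z p] C.H_sym[of z q] C.H_sym[of q p]
        by (simp add: C.H_simps l_def power2_eq_square algebra_simps)
    qed
    have a: "H' z z = l * H z z" "2 * H' p z = H z z * H' q z" "4 * H' p z = 8 * H z z * H' q z / 2"
      using nul[of 1] nul[of "-1"] nul[of 2] by (simp_all add: algebra_simps)
    then have pz: "H' p z = 0" by simp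
    \<comment> \<open>The same null vector with \<open>p\<close> and \<open>q\<close> exchanged and
      \<open>t = 1\<close>.\<close>
    let ?w = "q - (H z z / 2) *\<^sub>R p + z"
    have "H ?w ?w = 0" using p z H_sym[of z p] H_sym[of z q] H_sym[of q p] by (simp add: H_simps)
    from null[OF this] have "- H z z * l + H' z z + 2 * H' q z - H z z * H' p z = 0"
      using pq C.H_sym[of z p] C.H_sym[of z q] C.H_sym[of q p]
      by (simp add: C.H_simps l_def algebra_simps)
    then show ?thesis using a pz by simp
  qed
  have diag: "H' x x = l * H x x" for x
  proof -
    define z where "z = x - H x q *\<^sub>R p - H x p *\<^sub>R q"
    have "H p z = 0" "H q z = 0" using p H_sym[of q p] H_sym[of p x] H_sym[of q x]
      by (simp_all add: z_def H_simps)
    note m = main[OF this] this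
    have x: "x = z + H x q *\<^sub>R p + H x p *\<^sub>R q" by (simp add: z_def)
    have "H' x x = H' z z + 2 * H x q * H x p * l"
      by (subst (1 2) x) (use m pq C.H_sym[of z p] C.H_sym[of z q] C.H_sym[of q p] in \<open>simp add: C.H_simps l_def\<close>)
    moreover have "H x x = H z z + 2 * H x q * H x p"
      by (subst (1 2) x) (use m p H_sym[of z p] H_sym[of z q] H_sym[of q p] in \<open>simp add: H_simps\<close>)
    ultimately show ?thesis using m by (simp add: algebra_simps)
  qed
  have H': "H' x y = l * H x y" for x y
    using diag[of "x + y"] diag[of x] diag[of y] H_sym[of y x] C.H_sym[of y x]
    by (simp add: H_simps C.H_simps algebra_simps)
  have cr: "cr x y = l *\<^sub>R cr' x y" for x y
    by (rule nondegenerate_eq) (simp add: eq H' H_simps)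
  \<comment> \<open>With this choice \<open>H x p * H x q - H x x * H p q\<close> is
    \<open>1 - 2 = -1\<close>, so it can be cancelled.\<close>
  define x where "x = p + q"
  have "H (cr x (cr x p)) q = l\<^sup>2 * H (cr' x (cr' x p)) q"
    by (simp add: cr C.cr_simps H_simps power2_eq_square)
  then have "H x p * H x q - H x x * H p q = l\<^sup>2 * l * (H x p * H x q - H x x * H p q)"
    by (simp add: cr_cr C.cr_cr H' H_simps algebra_simps)
  then have "l ^ 3 = 1" using p H_sym[of q p]
    by (simp add: x_def H_simps power3_eq_cube power2_eq_square)
  then have "l = 1" using odd_real_root_power_cancel[of 3 l] by simp
  then show ?thesis using H' by (simp add: fun_eq_iff)
qed

end

declare One_nat_def [simp del]

subsection \<open>Alternating forms in a basis of seven vectors\<close>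

lemma one_form_wedge_Cons_only:
  "list_all (\<lambda>y. f y = 0) xs \<Longrightarrow> (one_form f \<and>\<^sub>f \<beta>) (x # xs) = f x * \<beta> xs"
  by (simp add: one_form_wedge_Cons one_form_wedge_eq_0 list_all_iff)

text \<open>Only vanishing is compared, which spares the sign of the permutation. Together with
  \<open>kform_mset_eq_0\<close> this suffices to treat top forms as one-dimensional.\<close>

lemma kform_move_front:
  assumes "kform k \<alpha>"
  shows "\<alpha> (us @ x # vs) = 0 \<longleftrightarrow> \<alpha> (x # us @ vs) = 0"
proof (cases "k = length us + Suc (length vs)")
  case True
  have "\<exists>s. s \<noteq> 0 \<and> \<alpha> (us @ x # vs) = s * \<alpha> (x # us @ vs)"
    if "kform (Suc n) \<alpha>" "Suc n = length us + Suc (length vs)" for n \<alpha>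
    using that
  proof (induction us arbitrary: \<alpha> n)
    case Nil
    show ?case by (rule exI[of _ 1]) simp
  next
    case (Cons u us)
    then obtain m where m: "n = Suc m" by (cases n) auto
    from Cons.IH[OF kform_interior_product[OF Cons.prems(1)[unfolded m]]] Cons.prems(2) m
    obtain s where "s \<noteq> 0" "\<alpha> (u # us @ x # vs) = s * \<alpha> (u # x # us @ vs)"
      by (auto simp: interior_product_def)
    then show ?case using kform_swap[OF Cons.prems(1), of u x] by (intro exI[of _ "- s"]) simp
  qed
  from this[of "k - 1" \<alpha>] True assms show ?thesis by fastforce
next
  case False
  then show ?thesis using kform_wrong_length[OF assms] by simp
qed

lemma kform_mset_eq_0:
  assumes "kform k \<alpha>" "mset xs = mset ys"
  shows "\<alpha> xs = 0 \<longleftrightarrow> \<alpha> ys = 0"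
  using assms
proof (induction xs arbitrary: k \<alpha> ys)
  case (Cons x xs)
  then have "x \<in> set ys" by (metis list.set_intros(1) set_mset_mset)
  then obtain us vs where ys: "ys = us @ x # vs" by (meson split_list)
  show ?case
  proof (cases k)
    case 0
    then show ?thesis using kform_wrong_length[OF Cons.prems(1)] ys by simp
  next
    case (Suc m)
    have "mset xs = mset (us @ vs)" using Cons.prems(2) ys by simp
    from Cons.IH[OF kform_interior_product[OF Cons.prems(1)[unfolded Suc]] this, of x]
    show ?thesis using kform_move_front[OF Cons.prems(1), of us x vs] ys
      by (simp add: interior_product_def)
  qed
qed simp

locale basis7 =
  fixes E :: "nat \<Rightarrow> 'v::real_vector"
  assumes is_basis: "is_basis7 E"
begin

definition co :: "nat \<Rightarrow> 'v \<Rightarrow> real" where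
  "co a x = representation (E ` {1..7}) x (E a)"

lemma indep: "independent (E ` {1..7})" and spans: "x \<in> span (E ` {1..7})" and inj: "inj_on E {1..7}"
  using is_basis by (auto simp: is_basis7_def)

lemma dim_UNIV: "dim (UNIV :: 'v set) = 7"
  using is_basis dim_eq_card_independent[OF indep] card_image[OF inj] dim_span[of "E ` {1..7}"]
  by (simp add: is_basis7_def)

lemma linear_co: "linear (co a)"
  by (rule linearI) (simp_all add: co_def real_vector.representation_add[OF indep spans spans]
      real_vector.representation_scale[OF indep spans])

lemma co_simps: "co a (x + y) = co a x + co a y" "co a (c *\<^sub>R x) = c * co a x"
  "co a (- x) = - co a x" "co a (x - y) = co a x - co a y" "co a 0 = 0"
  using linear_co[of a] by (simp_all add: linear_add linear_scale linear_neg linear_diff linear_0)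

lemma co_E: "a \<in> {1..7} \<Longrightarrow> b \<in> {1..7} \<Longrightarrow> co a (E b) = (if a = b then 1 else 0)"
  unfolding co_def using real_vector.representation_basis[OF indep, of "E b"] inj
  by (auto simp: inj_on_def)

lemma sum_co: "x = (\<Sum>a\<in>{1..7}. co a x *\<^sub>R E a)"
proof -
  have "x = (\<Sum>b\<in>E ` {1..7}. representation (E ` {1..7}) x b *\<^sub>R b)"
    using real_vector.sum_representation_eq[OF indep spans] by simp
  then show ?thesis by (simp add: co_def sum.reindex[OF inj] o_def)
qed

lemma linear_expand:
  assumes "linear f" shows "f x = (\<Sum>a\<in>{1..7}. co a x * f (E a) :: real)"
proof -
  have "f x = f (\<Sum>a\<in>{1..7}. co a x *\<^sub>R E a)" using sum_co[of x] by simp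
  then show ?thesis by (simp add: linear_sum[OF assms] linear_scale[OF assms])
qed

lemma co_ext: "(\<And>a. a \<in> {1..7} \<Longrightarrow> co a x = co a y) \<Longrightarrow> x = y"
  by (subst sum_co[of x], subst sum_co[of y]) (rule sum.cong, simp_all)

lemma dual_basis7_co: "dual_basis7 E a = one_form (co a)"
  by (simp add: dual_basis7_def co_def[abs_def])

lemma ewedge_co: "ewedge E is = wedges (map (\<lambda>a. one_form (co a)) is)"
  by (simp add: ewedge_def dual_basis7_co[abs_def])

lemma kform_ewedge: "kform (length is) (ewedge E is)"
  unfolding ewedge_co by (rule kform_wedges_one_forms) (rule linear_co)

lemma ewedge_3: "ewedge E [a, b, c] [x, y, z] =
    co a x * (co b y * co c z - co b z * co c y)
  - co a y * (co b x * co c z - co b z * co c x)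
  + co a z * (co b x * co c y - co b y * co c x)"
  by (simp add: ewedge_co wedges_Cons wedges_Nil one_form_wedge_Cons one_form_wedge_Nil
      interior_product_def algebra_simps)

lemma atLeast1_atMost7: "{1..7::nat} = {1, 2, 3, 4, 5, 6, 7}"
  by auto

abbreviation idx :: "nat list" where "idx \<equiv> [1, 2, 3, 4, 5, 6, 7]"

lemma ewedge_idx: "ewedge E idx (map E idx) = 1"
  by (simp add: ewedge_co wedges_Cons wedges_Nil one_form_wedge_Cons_only co_E)

lemma kform_eq_0_on_basis:
  assumes "kform k \<alpha>"
    and "\<And>is. length is = k \<Longrightarrow> set is \<subseteq> {1..7} \<Longrightarrow> \<alpha> (map E is) = 0"
  shows "\<alpha> = (\<lambda>xs. 0)"
  using assms
proof (induction k arbitrary: \<alpha>)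
  case 0
  then show ?case using kform_wrong_length[OF 0(1)] 0(2)[of "[]"] by (metis list.size(3) list.simps(8) empty_set empty_subsetI length_0_conv)
next
  case (Suc k)
  have b: "interior_product (E a) \<alpha> = (\<lambda>xs. 0)" if "a \<in> {1..7}" for a
  proof (rule Suc.IH[OF kform_interior_product[OF Suc.prems(1)]])
    show "interior_product (E a) \<alpha> (map E is) = 0" if "length is = k" "set is \<subseteq> {1..7}" for "is"
      using Suc.prems(2)[of "a # is"] that \<open>a \<in> {1..7}\<close> by (simp add: interior_product_def)
  qed
  show ?case
  proof
    fix xs
    show "\<alpha> xs = 0"
    proof (cases xs)
      case Nil
      then show ?thesis using kform_wrong_length[OF Suc.prems(1)] by simp
    next
      case (Cons x ys)
      have lin: "linear (\<lambda>x. \<alpha> (x # ys))" using kform_linear_Cons[OF Suc.prems(1)] .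
      have "\<alpha> (x # ys) = (\<Sum>a\<in>{1..7}. co a x * \<alpha> (E a # ys))" by (rule linear_expand[OF lin])
      also have "\<dots> = 0"
        using b by (intro sum.neutral) (auto simp: interior_product_def fun_eq_iff)
      finally show ?thesis using Cons by simp
    qed
  qed
qed

lemma kform_eq_0_on_distinct:
  assumes "kform k \<alpha>"
    and "\<And>is. length is = k \<Longrightarrow> set is \<subseteq> {1..7} \<Longrightarrow> distinct is \<Longrightarrow> \<alpha> (map E is) = 0"
  shows "\<alpha> = (\<lambda>xs. 0)"
proof (rule kform_eq_0_on_basis[OF assms(1)])
  fix "is" :: "nat list" assume *: "length is = k" "set is \<subseteq> {1..7}"
  show "\<alpha> (map E is) = 0"
  proof (cases "distinct is")
    case False
    then obtain i j where "i < length is" "j < length is" "i \<noteq> j" "is ! i = is ! j"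
      by (auto simp: distinct_conv_nth)
    then show ?thesis using kform_repeat[OF assms(1), of "map E is" i j] * by simp
  qed (use * assms(2) in blast)
qed

lemma kform7_eq_0:
  assumes "kform 7 \<alpha>" "\<alpha> (map E idx) = 0"
  shows "\<alpha> = (\<lambda>xs. 0)"
proof (rule kform_eq_0_on_distinct[OF assms(1)])
  fix "is" :: "nat list" assume *: "length is = 7" "set is \<subseteq> {1..7}" "distinct is"
  have "set is = {1..7}" using * by (intro card_subset_eq) (simp_all add: distinct_card)
  moreover have "set idx = {1..7}" "distinct idx" by (simp_all only: atLeast1_atMost7) simp_all
  ultimately have "mset is = mset idx" using *(3) by (metis set_eq_iff_mset_eq_distinct)
  then have "mset (map E is) = mset (map E idx)" by (metis mset_map)
  then show "\<alpha> (map E is) = 0" using kform_mset_eq_0[OF assms(1)] assms(2) by blast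
qed

lemma kform7_eqI:
  assumes "kform 7 \<alpha>" "kform 7 \<beta>" "\<alpha> (map E idx) = \<beta> (map E idx)"
  shows "\<alpha> = \<beta>"
  using kform7_eq_0[OF kform_diff[OF assms(1,2)]] assms(3) by (simp add: fun_eq_iff)

text \<open>Put \<open>x\<close> in place of a basis vector \<open>E a\<close> with nonzero
  coordinate \<open>co a x\<close>. Expanding \<open>x\<close>, all other terms repeat a basis
  vector, so the value on the basis times \<open>co a x\<close> is a value with \<open>x\<close>
  among its arguments, which is 0.\<close>

lemma kform7_annihilated:
  fixes \<alpha> :: "'v form"
  assumes \<alpha>: "kform 7 \<alpha>" and x: "x \<noteq> 0" "\<And>xs. \<alpha> (x # xs) = 0"
  shows "\<alpha> = (\<lambda>xs. 0)"
proof (rule kform7_eq_0[OF \<alpha>])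
  have "\<exists>a\<in>{1..7}. co a x \<noteq> 0" using co_ext[of x 0] x(1) unfolding co_simps by blast
  then obtain a where a: "a \<in> {1..7}" "co a x \<noteq> 0" by blast
  then have len: "a - 1 < 7" "a - 1 < length (map E idx)" by auto
  \<comment> \<open>Basis vectors are numbered from 1, list positions from 0.\<close>
  have nth: "idx ! (b - 1) = b" if "b \<in> {1..7}" for b
    using that unfolding atLeast1_atMost7 by auto
  let ?f = "\<lambda>v. \<alpha> ((map E idx)[a - 1 := v])"
  have lin: "linear ?f" by (rule kform_linear[OF \<alpha> _ len(1)]) simp
  have "mset ((map E idx)[a - 1 := x]) = mset (x # take (a - 1) (map E idx) @ drop a (map E idx))"
    using a(1) len(2) by (subst upd_conv_take_nth_drop[OF len(2)]) simp
  then have "?f x = 0" using kform_mset_eq_0[OF \<alpha>] x(2) by blast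
  moreover have "?f x = (\<Sum>b\<in>{1..7}. co b x * ?f (E b))" by (rule linear_expand[OF lin])
  also have "\<dots> = (\<Sum>b\<in>{a}. co b x * ?f (E b))"
  proof (rule sum.mono_neutral_right)
    show "\<forall>b\<in>{1..7} - {a}. co b x * ?f (E b) = 0"
    proof
      fix b assume b: "b \<in> {1..7} - {a}"
      have "?f (E b) = 0"
        by (rule kform_repeat[OF \<alpha>, of _ "a - 1" "b - 1"])
          (use a b nth[of b] len in \<open>auto simp: nth_list_update simp del: list.map\<close>)
      then show "co b x * ?f (E b) = 0" by simp
    qed
  qed (use a in auto)
  also have "\<dots> = co a x * ?f (E a)" by simp
  also have "(map E idx)[a - 1 := E a] = map E idx"
    using nth[OF a(1)] len(2) by (metis length_map list_update_id nth_map)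
  finally show "\<alpha> (map E idx) = 0" using a(2) by simp
qed

end

subsection \<open>The metric and the cross product of an adapted basis\<close>

context basis7
begin

definition metric :: "'v \<Rightarrow> 'v \<Rightarrow> real" where
  "metric x y = co 1 x * co 7 y + co 7 x * co 1 y + co 2 x * co 5 y + co 5 x * co 2 y
     + co 3 x * co 6 y + co 6 x * co 3 y - co 4 x * co 4 y"

text \<open>Obtained by raising the last index of the 3-form: \<open>metric\<close> pairs 1 with 7,
  2 with 5 and 3 with 6, so the coefficient of \<open>E 1\<close> is the value on
  \<open>x, y, E 7\<close>, and so on; that of \<open>E 4\<close> changes sign since
  \<open>E 4\<close> has norm -1.\<close>

definition cross :: "'v \<Rightarrow> 'v \<Rightarrow> 'v" where
  "cross x y = (let p = (\<lambda>a b. co a x * co b y - co b x * co a y) in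
     (sqrt 2 * p 2 3 - p 1 4) *\<^sub>R E 1 + (p 2 4 - sqrt 2 * p 1 6) *\<^sub>R E 2
     + (sqrt 2 * p 1 5 + p 3 4) *\<^sub>R E 3 + (p 2 5 + p 3 6 - p 1 7) *\<^sub>R E 4
     + (sqrt 2 * p 3 7 + p 4 5) *\<^sub>R E 5 + (p 4 6 - sqrt 2 * p 2 7) *\<^sub>R E 6
     + (sqrt 2 * p 5 6 - p 4 7) *\<^sub>R E 7)"

lemma co_cross:
  "co 1 (cross x y) = sqrt 2 * (co 2 x * co 3 y - co 3 x * co 2 y) - (co 1 x * co 4 y - co 4 x * co 1 y)"
  "co 2 (cross x y) = (co 2 x * co 4 y - co 4 x * co 2 y) - sqrt 2 * (co 1 x * co 6 y - co 6 x * co 1 y)"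
  "co 3 (cross x y) = sqrt 2 * (co 1 x * co 5 y - co 5 x * co 1 y) + (co 3 x * co 4 y - co 4 x * co 3 y)"
  "co 4 (cross x y) = (co 2 x * co 5 y - co 5 x * co 2 y) + (co 3 x * co 6 y - co 6 x * co 3 y)
     - (co 1 x * co 7 y - co 7 x * co 1 y)"
  "co 5 (cross x y) = sqrt 2 * (co 3 x * co 7 y - co 7 x * co 3 y) + (co 4 x * co 5 y - co 5 x * co 4 y)"
  "co 6 (cross x y) = (co 4 x * co 6 y - co 6 x * co 4 y) - sqrt 2 * (co 2 x * co 7 y - co 7 x * co 2 y)"
  "co 7 (cross x y) = sqrt 2 * (co 5 x * co 6 y - co 6 x * co 5 y) - (co 4 x * co 7 y - co 7 x * co 4 y)"
  by (simp_all add: cross_def Let_def co_simps co_E)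

lemma bilinear_metric: "bilinear metric"
  unfolding bilinear_def by (auto intro!: linearI simp: metric_def co_simps algebra_simps)

lemma bilinear_cross: "bilinear cross"
  unfolding bilinear_def by (auto intro!: linearI simp: cross_def Let_def co_simps algebra_simps)

text \<open>With \<open>sqrt 2\<close> replaced by a variable \<open>s\<close> this is a polynomial
  identity; the correction term is a multiple of \<open>s\<^sup>2 - 2\<close> and vanishes for
  \<open>sqrt 2\<close>.\<close>

lemma cross_norm_identity:
  fixes s x1 x2 x3 x4 x5 x6 x7 y1 y2 y3 y4 y5 y6 y7 :: real
  shows "2 * (s * (x2 * y3 - x3 * y2) - (x1 * y4 - x4 * y1)) * (s * (x5 * y6 - x6 * y5) - (x4 * y7 - x7 * y4))
      + 2 * ((x2 * y4 - x4 * y2) - s * (x1 * y6 - x6 * y1)) * (s * (x3 * y7 - x7 * y3) + (x4 * y5 - x5 * y4))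
      + 2 * (s * (x1 * y5 - x5 * y1) + (x3 * y4 - x4 * y3)) * ((x4 * y6 - x6 * y4) - s * (x2 * y7 - x7 * y2))
      - ((x2 * y5 - x5 * y2) + (x3 * y6 - x6 * y3) - (x1 * y7 - x7 * y1))\<^sup>2
    = (x1 * x7 + x7 * x1 + x2 * x5 + x5 * x2 + x3 * x6 + x6 * x3 - x4 * x4)
      * (y1 * y7 + y7 * y1 + y2 * y5 + y5 * y2 + y3 * y6 + y6 * y3 - y4 * y4)
      - (x1 * y7 + x7 * y1 + x2 * y5 + x5 * y2 + x3 * y6 + x6 * y3 - x4 * y4)\<^sup>2
      + 2 * (s\<^sup>2 - 2) * ((x2 * y3 - x3 * y2) * (x5 * y6 - x6 * y5)
          - (x1 * y6 - x6 * y1) * (x3 * y7 - x7 * y3) - (x1 * y5 - x5 * y1) * (x2 * y7 - x7 * y2))"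
  by algebra

lemma metric_cross_self:
  "metric (cross x y) (cross x y) = metric x x * metric y y - (metric x y)\<^sup>2"
proof -
  have "metric z z = 2 * co 1 z * co 7 z + 2 * co 2 z * co 5 z + 2 * co 3 z * co 6 z - (co 4 z)\<^sup>2" for z
    by (simp add: metric_def power2_eq_square)
  then have "metric (cross x y) (cross x y) = 2 * co 1 (cross x y) * co 7 (cross x y)
      + 2 * co 2 (cross x y) * co 5 (cross x y) + 2 * co 3 (cross x y) * co 6 (cross x y)
      - (co 4 (cross x y))\<^sup>2" .
  then show ?thesis unfolding co_cross cross_norm_identity metric_def by simp
qed

lemma metric_dual: "a \<in> {1..7} \<Longrightarrow> \<exists>d. \<forall>y. metric d y = co a y"
proof -
  have "metric (E 7) y = co 1 y" "metric (E 5) y = co 2 y" "metric (E 6) y = co 3 y"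
    "metric (- E 4) y = co 4 y" "metric (E 2) y = co 5 y" "metric (E 3) y = co 6 y"
    "metric (E 1) y = co 7 y" for y
    by (simp_all add: metric_def co_E co_simps)
  moreover assume "a \<in> {1..7}"
  ultimately show ?thesis unfolding atLeast1_atMost7 by blast
qed

sublocale cross_product metric cross
proof
  fix x y
  show "metric x y = metric y x" by (simp add: metric_def)
  show "cross x x = 0" by (simp add: cross_def)
  show "metric (cross x y) x = 0" unfolding metric_def co_cross by (simp add: algebra_simps)
  show "x = 0" if z: "\<And>z. metric x z = 0"
  proof (rule co_ext)
    fix a :: nat assume "a \<in> {1..7}"
    then obtain d where "\<And>y. metric d y = co a y" using metric_dual by blast
    moreover have "metric d x = metric x d" by (simp add: metric_def)
    ultimately show "co a x = co a 0" using z[of d] by (simp add: co_simps)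
  qed
qed (rule bilinear_metric bilinear_cross metric_cross_self)+

lemma metric_E: "a \<in> {1..7} \<Longrightarrow> b \<in> {1..7} \<Longrightarrow> metric (E a) (E b) = model_gram a b"
  unfolding atLeast1_atMost7
  by (elim insertE emptyE; simp add: metric_def co_E model_gram_def doubleton_eq_iff)

section \<open>The volume form and the sign of a reflection\<close>

definition volume :: "'v form" where
  "volume xs = - ewedge E idx xs"

lemma kform_volume: "kform 7 volume"
  using kform_scale[OF kform_ewedge[of idx], of "-1"] by (simp add: volume_def[abs_def] numeral_eq_Suc)

lemma volume_E: "volume (map E idx) = - 1"
  using ewedge_idx by (simp add: volume_def)

text \<open>The reflection changes each argument by a multiple of \<open>x\<close>, which the form
  does not see.\<close>

lemma kform_reflect_fixed:
  assumes "kform k \<theta>" "\<And>ys. \<theta> (x # ys) = 0"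
  shows "\<theta> (map (reflect x) xs) = \<theta> xs"
  using assms
proof (induction xs arbitrary: k \<theta>)
  case (Cons y xs)
  show ?case
  proof (cases k)
    case 0
    then show ?thesis using kform_wrong_length[OF Cons.prems(1)] by simp
  next
    case (Suc m)
    have lin: "linear (\<lambda>y. \<theta> (y # map (reflect x) xs))" using kform_linear_Cons[OF Cons.prems(1)] .
    have "\<theta> (reflect x y # map (reflect x) xs) = \<theta> (y # map (reflect x) xs)"
      using Cons.prems(2) by (simp add: reflect_def linear_diff[OF lin] linear_scale[OF lin])
    also have "interior_product y \<theta> (map (reflect x) xs) = interior_product y \<theta> xs"
      using Cons.prems(1) kform_swap[OF Cons.prems(1), of y x] Cons.prems(2)
      by (intro Cons.IH[of m] kform_interior_product) (simp_all add: Suc interior_product_def)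
    then have "\<theta> (y # map (reflect x) xs) = \<theta> (y # xs)" by (simp add: interior_product_def)
    finally show ?thesis by simp
  qed
qed simp

text \<open>Replaces the statement that a reflection has determinant -1. The contraction of \<omega>
  with \<open>x\<close> is invariant under the reflection while \<open>x\<close> itself changes
  sign, so the sum of \<omega> and its pullback is annihilated by \<open>x\<close>.\<close>

lemma kform7_reflect:
  assumes \<omega>: "kform 7 \<omega>" and x: "metric x x \<noteq> 0"
  shows "\<omega> (map (reflect x) ys) = - \<omega> ys"
proof -
  have "(\<lambda>ys. \<omega> (map (reflect x) ys) + \<omega> ys) = (\<lambda>ys. 0)"
  proof (rule kform7_annihilated[of _ x])
    show "kform 7 (\<lambda>ys. \<omega> (map (reflect x) ys) + \<omega> ys)"
      by (intro kform_add kform_map \<omega> linear_reflect)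
    show "x \<noteq> 0" using x by (auto simp: H_simps)
    fix xs
    have "interior_product x \<omega> (map (reflect x) xs) = interior_product x \<omega> xs"
      using \<omega> kform_Cons_Cons_self[OF \<omega>, of x]
      by (intro kform_reflect_fixed[of 6] kform_interior_product) (simp_all add: interior_product_def)
    moreover have "\<omega> (- x # map (reflect x) xs) = - \<omega> (x # map (reflect x) xs)"
      using linear_neg[OF kform_linear_Cons[OF \<omega>]] .
    moreover have "reflect x x = - x" using x by (simp add: reflect_def scaleR_2)
    ultimately show "\<omega> (map (reflect x) (x # xs)) + \<omega> (x # xs) = 0"
      by (simp add: interior_product_def)
  qed
  then show ?thesis by (simp add: fun_eq_iff eq_neg_iff_add_eq_0)
qed

text \<open>The sign \<open>s\<close> is the determinant of \<open>g\<close>. Each reflection flips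
  it in both claims and replaces \<open>q\<close> by \<open>cliff x q\<close>, which is why the
  second claim is proved for all nonnull \<open>q\<close> at once.\<close>

lemma reflect_gen_spin_form:
  assumes "reflect_gen g" and \<omega>: "kform 7 \<omega>"
  shows "\<exists>s\<in>{1, -1}. (\<forall>xs. \<omega> (map g xs) = s * \<omega> xs) \<and>
    (\<forall>q. spinor_ip q q \<noteq> 0 \<longrightarrow>
      (\<exists>q'. spinor_ip q' q' \<noteq> 0 \<and> (\<forall>a b c. spin_form q (g a) (g b) (g c) = s * spin_form q' a b c)))"
  using assms(1)
proof induction
  case reflect_gen_id
  show ?case by (rule bexI[of _ 1]) auto
next
  case (reflect_gen_reflect x g)
  then obtain s where s: "s \<in> {1, -1}" "\<And>xs. \<omega> (map g xs) = s * \<omega> xs"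
    "\<And>q. spinor_ip q q \<noteq> 0 \<Longrightarrow>
      \<exists>q'. spinor_ip q' q' \<noteq> 0 \<and> (\<forall>a b c. spin_form q (g a) (g b) (g c) = s * spin_form q' a b c)"
    by blast
  have "\<omega> (map (\<lambda>y. reflect x (g y)) xs) = - s * \<omega> xs" for xs
    using kform7_reflect[OF \<omega> reflect_gen_reflect(1), of "map g xs"] s(2) by (simp add: o_def)
  moreover have "\<exists>q'. spinor_ip q' q' \<noteq> 0 \<and>
      (\<forall>a b c. spin_form q (reflect x (g a)) (reflect x (g b)) (reflect x (g c)) = - s * spin_form q' a b c)"
    if "spinor_ip q q \<noteq> 0" for q
    using s(3)[of "cliff x q"] that reflect_gen_reflect(1)
    by (simp add: spin_form_reflect ip_cliff_cliff)
  ultimately show ?case using s(1) by (intro bexI[of _ "- s"]) auto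
qed

lemma reflect_gen_orthogonal:
  assumes "orthogonal_map g" shows "reflect_gen g"
proof (rule reflect_gen_if_fixes[OF assms, of "{}"])
  \<comment> \<open>Sums and differences of the hyperbolic pairs, together with \<open>E 4\<close>,
    form an orthogonal basis of nonnull vectors.\<close>
  let ?us = "[E 1 + E 7, E 1 - E 7, E 2 + E 5, E 2 - E 5, E 3 + E 6, E 3 - E 6, E 4]"
  show "metric u u \<noteq> 0" if "u \<in> set ?us" for u
    using that by (auto simp: metric_def co_simps co_E)
  show "sorted_wrt (\<lambda>u w. metric u w = 0) ?us"
    by (simp add: metric_def co_simps co_E)
  have half: "a \<in> span (set ?us) \<and> b \<in> span (set ?us)" if "a + b \<in> set ?us" "a - b \<in> set ?us" for a b
  proof -
    have "a = (1/2) *\<^sub>R (a + b) + (1/2) *\<^sub>R (a - b)" "b = (1/2) *\<^sub>R (a + b) - (1/2) *\<^sub>R (a - b)"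
      by (simp_all add: algebra_simps flip: scaleR_add_left)
    then show ?thesis using that by (metis span_add span_base span_diff span_scale)
  qed
  have "E ` {1..7} \<subseteq> span (set ?us)"
    using half[of "E 1" "E 7"] half[of "E 2" "E 5"] half[of "E 3" "E 6"] span_base[of "E 4" "set ?us"]
    unfolding atLeast1_atMost7 by simp
  then have "span (E ` {1..7}) \<subseteq> span (set ?us)" by (metis span_mono span_span)
  then show "span (set ?us \<union> {}) = UNIV" using spans by auto
qed auto

end

subsection \<open>The Hodge dual of an adapted form\<close>

lemma kform_4I:
  fixes f :: "'v::real_vector \<Rightarrow> 'v \<Rightarrow> 'v \<Rightarrow> 'v \<Rightarrow> real"
  assumes "\<And>y z w. linear (\<lambda>x. f x y z w)" "\<And>x z w. linear (\<lambda>y. f x y z w)"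
    "\<And>x y w. linear (\<lambda>z. f x y z w)" "\<And>x y z. linear (\<lambda>w. f x y z w)"
    and "\<And>x z w. f x x z w = 0" "\<And>x y w. f x y y w = 0" "\<And>x y z. f x y z z = 0"
  shows "kform 4 (\<lambda>xs. case xs of [x, y, z, w] \<Rightarrow> f x y z w | _ \<Rightarrow> 0)"
proof -
  have lin: "linear (\<lambda>v. case xs of [] \<Rightarrow> g v | y # ys \<Rightarrow> h v y ys)"
    if "linear g" "\<And>y ys. linear (\<lambda>v. h v y ys)" for g :: "'v \<Rightarrow> real" and h and xs :: "'v list"
    using that by (cases xs) simp_all
  have "4 = Suc (Suc (Suc (Suc 0)))" by simp
  then show ?thesis
    by (simp only:, intro kform_SucI kform_0I)
      (auto intro!: lin simp: interior_product_def assms module_hom_zero split: list.split)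
qed

context basis7
begin

definition psi_form :: "'v form" where
  "psi_form xs = (case xs of [x, y, z, w] \<Rightarrow> psi x y z w | _ \<Rightarrow> 0)"

lemma kform_psi_form: "kform 4 psi_form"
  unfolding psi_form_def[abs_def]
  by (rule kform_4I)
    (auto intro!: linearI simp: psi_12 psi_23 psi_34, simp_all add: psi_def H_simps cr_simps algebra_simps)

definition g2_form :: "'v form" where
  "g2_form xs = - ewedge E [1,4,7] xs + sqrt 2 * ewedge E [1,5,6] xs
     + sqrt 2 * ewedge E [2,3,7] xs + ewedge E [2,4,5] xs + ewedge E [3,4,6] xs"

lemma kform_g2_form: "kform 3 g2_form"
proof -
  have k: "kform 3 (\<lambda>xs. c * ewedge E [a, b, d] xs)" for a b c d
    using kform_scale[OF kform_ewedge[of "[a, b, d]"]] by (simp add: numeral_3_eq_3)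
  have "kform 3 (\<lambda>xs. (- 1) * ewedge E [1,4,7] xs + sqrt 2 * ewedge E [1,5,6] xs
     + sqrt 2 * ewedge E [2,3,7] xs + 1 * ewedge E [2,4,5] xs + 1 * ewedge E [3,4,6] xs)"
    by (intro kform_add k)
  then show ?thesis by (simp add: g2_form_def[abs_def])
qed

lemma g2_form_cross: "g2_form [x, y, z] = metric (cross x y) z"
  unfolding g2_form_def ewedge_3 metric_def co_cross by (simp add: algebra_simps)

text \<open>Uniqueness of the Hodge star. For four distinct indices take the three missing ones:
  their dual covectors are flats of vectors, and wedging with them isolates the value of \<delta> on
  the four given basis vectors.\<close>

lemma kform_eq_0_if_wedge:
  assumes \<delta>: "kform 4 \<delta>"
    and w: "\<And>xs. length xs = 3 \<Longrightarrow> wedges (map (flat metric) xs) \<and>\<^sub>f \<delta> = (\<lambda>ys. 0)"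
  shows "\<delta> = (\<lambda>xs. 0)"
proof (rule kform_eq_0_on_distinct[OF \<delta>])
  fix "is" :: "nat list" assume *: "length is = 4" "set is \<subseteq> {1..7}" "distinct is"
  have "card ({1..7} - set is) = 3" using * by (simp add: card_Diff_subset distinct_card)
  moreover obtain js where js: "set js = {1..7} - set is" "distinct js"
    using finite_distinct_list[of "{1..7} - set is"] by auto
  ultimately have "length js = 3" using distinct_card by metis
  then obtain a b c where abc: "js = [a, b, c]" by (auto simp: numeral_3_eq_3 length_Suc_conv)
  have ab: "a \<in> {1..7}" "b \<in> {1..7}" "c \<in> {1..7}" "a \<notin> set is" "b \<notin> set is" "c \<notin> set is"
    "distinct [a, b, c]" using js abc by auto
  obtain u v t where d: "metric u = co a" "metric v = co b" "metric t = co c"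
    using metric_dual ab(1-3) by (metis ext)
  have z: "list_all (\<lambda>y. co i y = 0) (map E ks)"
    if "i \<in> {1..7}" "i \<notin> set ks" "set ks \<subseteq> {1..7}" for i ks
    using that by (auto simp: list_all_iff co_E)
  have "0 = (wedges (map (flat metric) [u, v, t]) \<and>\<^sub>f \<delta>) (map E (a # b # c # is))"
    using w[of "[u, v, t]"] by simp
  also have "\<dots> = \<delta> (map E is)"
    using ab z[of a "b # c # is"] z[of b "c # is"] z[of c "is"] *(2)
    by (simp add: wedges_Cons wedges_Nil wedge_assoc unit_wedge flat_def d one_form_wedge_Cons_only co_E)
  finally show "\<delta> (map E is) = 0" by simp
qed

text \<open>Both sides are 7-forms, so it suffices to evaluate them once on the basis, which leaves
  a polynomial identity in the coordinates of \<open>a\<close>, \<open>b\<close>,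
  \<open>c\<close>.\<close>

lemma wedge_psi_form:
  "wedges (map (flat metric) [a, b, c]) \<and>\<^sub>f psi_form = (\<lambda>ys. g2_form [a, b, c] * volume ys)"
proof (rule kform7_eqI)
  have "linear (metric x)" for x using bilinear_metric by (simp add: bilinear_def)
  then show "kform 7 (wedges (map (flat metric) [a, b, c]) \<and>\<^sub>f psi_form)"
    using kform_one_form_wedge[OF _ kform_one_form_wedge[OF _ kform_one_form_wedge[OF _ kform_psi_form]]]
    by (simp add: wedges_Cons wedges_Nil wedge_assoc unit_wedge flat_def numeral_eq_Suc)
  show "kform 7 (\<lambda>ys. g2_form [a, b, c] * volume ys)" by (intro kform_scale kform_volume)
  have mE: "metric x (E 1) = co 7 x" "metric x (E 2) = co 5 x" "metric x (E 3) = co 6 x"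
    "metric x (E 4) = - co 4 x" "metric x (E 5) = co 2 x" "metric x (E 6) = co 3 x" "metric x (E 7) = co 1 x" for x
    by (simp_all add: metric_def co_E)
  have cE: "metric x (cross y z) = co 1 x * co 7 (cross y z) + co 7 x * co 1 (cross y z)
      + co 2 x * co 5 (cross y z) + co 5 x * co 2 (cross y z) + co 3 x * co 6 (cross y z)
      + co 6 x * co 3 (cross y z) - co 4 x * co 4 (cross y z)" for x y z
    by (simp add: metric_def)
  \<comment> \<open>The values on the 35 increasing quadruples; the five nonzero ones are the
    coefficients of the dual 4-form.\<close>
  have psi_E:
    "psi (E 1) (E 2) (E 3) (E 4) = 0" "psi (E 1) (E 2) (E 3) (E 5) = 0"
    "psi (E 1) (E 2) (E 3) (E 6) = 0" "psi (E 1) (E 2) (E 3) (E 7) = 0"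
    "psi (E 1) (E 2) (E 4) (E 5) = 0" "psi (E 1) (E 2) (E 4) (E 6) = 0"
    "psi (E 1) (E 2) (E 4) (E 7) = 0" "psi (E 1) (E 2) (E 5) (E 6) = 0"
    "psi (E 1) (E 2) (E 5) (E 7) = 1" "psi (E 1) (E 2) (E 6) (E 7) = 0"
    "psi (E 1) (E 3) (E 4) (E 5) = 0" "psi (E 1) (E 3) (E 4) (E 6) = 0"
    "psi (E 1) (E 3) (E 4) (E 7) = 0" "psi (E 1) (E 3) (E 5) (E 6) = 0"
    "psi (E 1) (E 3) (E 5) (E 7) = 0" "psi (E 1) (E 3) (E 6) (E 7) = 1"
    "psi (E 1) (E 4) (E 5) (E 6) = - sqrt 2" "psi (E 1) (E 4) (E 5) (E 7) = 0"
    "psi (E 1) (E 4) (E 6) (E 7) = 0" "psi (E 1) (E 5) (E 6) (E 7) = 0"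
    "psi (E 2) (E 3) (E 4) (E 5) = 0" "psi (E 2) (E 3) (E 4) (E 6) = 0"
    "psi (E 2) (E 3) (E 4) (E 7) = - sqrt 2" "psi (E 2) (E 3) (E 5) (E 6) = 1"
    "psi (E 2) (E 3) (E 5) (E 7) = 0" "psi (E 2) (E 3) (E 6) (E 7) = 0"
    "psi (E 2) (E 4) (E 5) (E 6) = 0" "psi (E 2) (E 4) (E 5) (E 7) = 0"
    "psi (E 2) (E 4) (E 6) (E 7) = 0" "psi (E 2) (E 5) (E 6) (E 7) = 0"
    "psi (E 3) (E 4) (E 5) (E 6) = 0" "psi (E 3) (E 4) (E 5) (E 7) = 0"
    "psi (E 3) (E 4) (E 6) (E 7) = 0" "psi (E 3) (E 5) (E 6) (E 7) = 0"
    "psi (E 4) (E 5) (E 6) (E 7) = 0"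
    by (simp_all add: psi_def cE mE co_E co_cross)
  show "(wedges (map (flat metric) [a, b, c]) \<and>\<^sub>f psi_form) (map E idx)
      = g2_form [a, b, c] * volume (map E idx)"
    unfolding volume_E g2_form_cross
    apply (simp add: wedges_Cons wedges_Nil wedge_assoc unit_wedge flat_def one_form_wedge_Cons one_form_wedge_Nil
      interior_product_def mE psi_form_def psi_E)
    unfolding metric_def co_cross
    apply (simp add: algebra_simps)
    done
qed

lemma hodge_star_g2_form: "hodge_star metric volume 3 g2_form = psi_form"
  unfolding hodge_star_def dim_UNIV
proof (rule the_equality)
  have ex: "wedges (map (flat metric) xs) \<and>\<^sub>f psi_form = (\<lambda>ys. g2_form xs * volume ys)"
    if len: "length xs = 3" for xs
  proof -
    obtain a b c where "xs = [a, b, c]" using len by (auto simp: numeral_3_eq_3 length_Suc_conv)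
    then show ?thesis using wedge_psi_form by simp
  qed
  then show "kform (7 - 3) psi_form \<and> (\<forall>xs. length xs = 3 \<longrightarrow>
      wedges (map (flat metric) xs) \<and>\<^sub>f psi_form = (\<lambda>ys. g2_form xs * volume ys))"
    using kform_psi_form by simp
  fix \<gamma>
  assume \<gamma>: "kform (7 - 3) \<gamma> \<and> (\<forall>xs. length xs = 3 \<longrightarrow>
      wedges (map (flat metric) xs) \<and>\<^sub>f \<gamma> = (\<lambda>ys. g2_form xs * volume ys))"
  have "(\<lambda>xs. \<gamma> xs + -1 * psi_form xs) = (\<lambda>xs. 0)"
  proof (rule kform_eq_0_if_wedge)
    show "kform 4 (\<lambda>xs. \<gamma> xs + -1 * psi_form xs)"
      using \<gamma> by (intro kform_add kform_scale kform_psi_form) simp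
    show "wedges (map (flat metric) xs) \<and>\<^sub>f (\<lambda>xs. \<gamma> xs + -1 * psi_form xs) = (\<lambda>ys. 0)"
      if "length xs = 3" for xs
      using \<gamma> ex[OF that] that unfolding fun_eq_iff wedge_add_right wedge_scale_right by simp
  qed
  then show "\<gamma> = psi_form" by (simp add: fun_eq_iff)
qed

lemma adapted_g2_form: "adapted E \<Phi> \<longleftrightarrow> \<Phi> = g2_form"
  using is_basis by (auto simp: adapted_def g2_form_def[abs_def])

end

subsection \<open>Comparing two adapted bases\<close>

lemma kform3_eqI:
  assumes "kform 3 \<alpha>" "kform 3 \<beta>" "\<And>a b c. \<alpha> [a, b, c] = \<beta> [a, b, c]"
  shows "\<alpha> = \<beta>"
proof
  fix xs
  show "\<alpha> xs = \<beta> xs"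
  proof (cases "length xs = 3")
    case True
    then obtain a b c where "xs = [a, b, c]" by (auto simp: numeral_3_eq_3 length_Suc_conv)
    then show ?thesis using assms(3) by simp
  qed (simp add: assms(1,2)[THEN kform_wrong_length])
qed

locale two_bases = E: basis7 E + F: basis7 F for E F :: "nat \<Rightarrow> 'v::real_vector"
begin

context
  fixes g assumes g: "linear g" "\<And>a. a \<in> {1..7} \<Longrightarrow> g (F a) = E a"
begin

lemma co_change: "a \<in> {1..7} \<Longrightarrow> E.co a (g x) = F.co a x"
proof -
  assume a: "a \<in> {1..7}"
  have "linear (\<lambda>x. E.co a (g x))" using linear_compose[OF g(1) E.linear_co] by (simp only: o_def)
  then have "E.co a (g x) = (\<Sum>b\<in>{1..7}. F.co b x * E.co a (g (F b)))" by (rule F.linear_expand)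
  also have "\<dots> = (\<Sum>b\<in>{1..7}. if a = b then F.co b x else 0)"
    by (rule sum.cong) (use a in \<open>auto simp: g(2) E.co_E\<close>)
  finally show ?thesis using a by simp
qed

lemma metric_change: "E.metric (g x) (g y) = F.metric x y"
  by (simp add: E.metric_def F.metric_def co_change)

lemma ewedge_change: "set is \<subseteq> {1..7} \<Longrightarrow> ewedge E is (map g xs) = ewedge F is xs"
proof -
  assume "set is \<subseteq> {1..7}"
  then have "map (\<lambda>a. one_form (\<lambda>x. E.co a (g x))) is = map (\<lambda>a. one_form (F.co a)) is"
    by (auto simp: co_change)
  then show ?thesis by (simp only: E.ewedge_co F.ewedge_co wedges_one_form_map)
qed

lemma g2_form_change: "E.g2_form (map g xs) = F.g2_form xs"
  by (simp add: E.g2_form_def F.g2_form_def ewedge_change)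

lemma volume_change: "E.volume (map g xs) = F.volume xs"
  by (simp add: E.volume_def F.volume_def ewedge_change)

end

lemma exists_change: "\<exists>g. linear g \<and> (\<forall>a\<in>{1..7}. g (F a) = E a)"
proof (intro exI conjI ballI)
  let ?g = "\<lambda>x. \<Sum>b\<in>{1..7}. F.co b x *\<^sub>R E b"
  show "linear ?g"
    by (rule linearI) (simp_all add: F.co_simps scaleR_add_left sum.distrib scaleR_sum_right)
  fix a :: nat assume a: "a \<in> {1..7}"
  have "?g (F a) = (\<Sum>b\<in>{1..7}. if a = b then E b else 0)"
    by (rule sum.cong) (use a in \<open>auto simp: F.co_E\<close>)
  then show "?g (F a) = E a" using a by simp
qed

text \<open>The change of basis from \<open>F\<close> to \<open>E\<close> is orthogonal, hence
  generated by reflections; following the spinor \<open>(1, 0)\<close> through them yields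
  \<open>q\<close>.\<close>

lemma spin_form_if_same_metric:
  assumes "F.metric = E.metric"
  obtains s q where "s \<in> {1, -1}" "E.spinor_ip q q \<noteq> 0" "\<And>xs. F.volume xs = s * E.volume xs"
    "\<And>a b c. F.g2_form [a, b, c] = s * E.spin_form q a b c"
proof -
  obtain g where g: "linear g" "\<And>a. a \<in> {1..7} \<Longrightarrow> g (F a) = E a" using exists_change by blast
  have "E.orthogonal_map g"
    using g(1) metric_change[OF g] assms by (simp add: E.orthogonal_map_def)
  from E.reflect_gen_spin_form[OF E.reflect_gen_orthogonal[OF this] E.kform_volume]
  obtain s where s: "s \<in> {1, -1}" "\<And>xs. E.volume (map g xs) = s * E.volume xs"
    "\<And>q. E.spinor_ip q q \<noteq> 0 \<Longrightarrow> \<exists>q'. E.spinor_ip q' q' \<noteq> 0 \<and>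
      (\<forall>a b c. E.spin_form q (g a) (g b) (g c) = s * E.spin_form q' a b c)" by blast
  have "E.spinor_ip (1, 0) (1, 0) \<noteq> 0" by (simp add: E.spinor_ip_def E.H_simps)
  from s(3)[OF this] obtain q where q: "E.spinor_ip q q \<noteq> 0"
    "\<And>a b c. E.spin_form (1, 0) (g a) (g b) (g c) = s * E.spin_form q a b c" by blast
  have "F.g2_form [a, b, c] = s * E.spin_form q a b c" for a b c
    using g2_form_change[OF g, of "[a, b, c]"] q(2)[of a b c] by (simp add: E.g2_form_cross E.spin_form_one)
  then show thesis using that s q(1) volume_change[OF g] by simp
qed

lemma metric_eq:
  assumes "E.g2_form = F.g2_form" shows "F.metric = E.metric"
proof (rule E.metric_unique[of F.metric F.cross "E 1" "E 7"])
  show "E.metric (E.cross x y) z = F.metric (F.cross x y) z" for x y z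
    using assms E.g2_form_cross F.g2_form_cross by metis
  show "3 < dim (UNIV :: 'v set)" using E.dim_UNIV by simp
qed (simp_all add: F.cross_product_axioms E.metric_def E.co_E)

text \<open>The sign \<open>-1\<close> cannot occur: contracted with the vector part \<open>v\<close> of the spinor, \<open>\<Phi>\<close>
  does not change, so \<open>v\<close> would annihilate \<open>\<Phi>\<close>.\<close>

lemma volume_eq:
  assumes "E.g2_form = F.g2_form" shows "F.volume = E.volume"
proof -
  obtain s q where s: "s \<in> {1, -1}" and q: "E.spinor_ip q q \<noteq> 0"
    and vol: "\<And>xs. F.volume xs = s * E.volume xs"
    and form: "\<And>a b c. F.g2_form [a, b, c] = s * E.spin_form q a b c"
    using spin_form_if_same_metric[OF metric_eq[OF assms]] by blast
  have "s \<noteq> -1"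
  proof
    assume "s = -1"
    obtain r v where rv: "q = (r, v)" by (cases q)
    have neg: "E.metric (E.cross a b) c = - E.spin_form (r, v) a b c" for a b c
      using form[of a b c] \<open>s = -1\<close> rv assms E.g2_form_cross[of a b c] by simp
    have "E.metric (E.cross v b) c = 0" for b c
      using neg[of v b c] E.spin_form_expand[of r v v b c] q rv
      by (simp add: E.cr_self E.psi_12 E.H_simps)
    then have "E.cross v b = 0" for b by (rule E.nondegenerate)
    \<comment> \<open>Components 4 of these products are, up to sign, the coordinates of
      \<open>v\<close> other than the fourth, which is component 1 of
      \<open>cross v (E 1)\<close>.\<close>
    then have v: "E.co 4 (E.cross v (E 7)) = 0" "E.co 4 (E.cross v (E 1)) = 0"
      "E.co 4 (E.cross v (E 2)) = 0" "E.co 4 (E.cross v (E 5)) = 0" "E.co 4 (E.cross v (E 3)) = 0"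
      "E.co 4 (E.cross v (E 6)) = 0" "E.co 1 (E.cross v (E 1)) = 0"
      by (simp_all add: E.co_simps)
    have "v = 0"
      by (rule E.co_ext, unfold E.atLeast1_atMost7) (use v in \<open>auto simp: E.co_cross E.co_E E.co_simps\<close>)
    \<comment> \<open>For \<open>v = 0\<close> the spinor form is the 3-form itself, which would
      equal its negative; but its value on \<open>E 1, E 4, E 7\<close> is -1.\<close>
    then have "E.metric (E.cross (E 1) (E 4)) (E 7) = 0"
      using neg[of "E 1" "E 4" "E 7"] E.spin_form_expand[of r v "E 1" "E 4" "E 7"] q rv
      by (simp add: E.H_simps E.cr_simps E.psi_def)
    then show False by (simp add: E.metric_def E.co_cross E.co_E)
  qed
  then show ?thesis using s vol by auto
qed

end

section \<open>The defined invariants of an adapted form, and its deformations\<close>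

context basis7
begin

lemma adapted_form_eq: "adapted F g2_form \<Longrightarrow> basis7 F \<and> basis7.g2_form F = g2_form"
  by (metis adapted_def basis7.adapted_g2_form basis7_def)

lemma adapted_self: "adapted E g2_form"
  by (simp add: adapted_g2_form)

lemma bilinear_eq_on_basis:
  assumes "bilinear h" "bilinear h'"
    "\<And>a b. a \<in> {1..7} \<Longrightarrow> b \<in> {1..7} \<Longrightarrow> h (E a) (E b) = (h' (E a) (E b) :: real)"
  shows "h = h'"
proof (intro ext)
  fix x y
  have lin: "linear (\<lambda>x. h x y)" "linear (\<lambda>y. h x y)" if "bilinear h" for h :: "'v \<Rightarrow> 'v \<Rightarrow> real" and x y
    using that by (simp_all add: bilinear_def)
  have "h x y = (\<Sum>a\<in>{1..7}. co a x * (\<Sum>b\<in>{1..7}. co b y * h (E a) (E b)))" if "bilinear h"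
    for h :: "'v \<Rightarrow> 'v \<Rightarrow> real"
    using linear_expand[OF lin(1)[OF that], of x y] linear_expand[OF lin(2)[OF that], of _ y] by simp
  note this[OF assms(1)] this[OF assms(2)]
  then show "h x y = h' x y" using assms(3) by simp
qed

text \<open>Independence of the adapted basis is \<open>metric_eq\<close>; uniqueness in the
  description holds because \<open>E\<close> itself is adapted.\<close>

lemma g2_metric_g2_form: "g2_metric g2_form = metric"
  unfolding g2_metric_def
proof (rule the_equality)
  show "bilinear metric \<and> (\<forall>F. adapted F g2_form \<longrightarrow>
      (\<forall>a\<in>{1..7}. \<forall>b\<in>{1..7}. metric (F a) (F b) = model_gram a b))"
  proof (intro conjI allI impI ballI bilinear_metric)
    fix F a b assume F: "adapted F g2_form" and ab: "a \<in> {1..7::nat}" "b \<in> {1..7::nat}"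
    interpret F: basis7 F using adapted_form_eq[OF F] by blast
    interpret two_bases E F ..
    have "F.metric = metric" using metric_eq adapted_form_eq[OF F] by simp
    then show "metric (F a) (F b) = model_gram a b" using F.metric_E[OF ab] by simp
  qed
  show "h = metric" if "bilinear h \<and> (\<forall>F. adapted F g2_form \<longrightarrow>
      (\<forall>a\<in>{1..7}. \<forall>b\<in>{1..7}. h (F a) (F b) = model_gram a b))" for h
    using that adapted_self metric_E by (intro bilinear_eq_on_basis bilinear_metric) auto
qed

lemma g2_volume_g2_form: "g2_volume g2_form = volume"
  unfolding g2_volume_def
proof (rule the_equality)
  show "\<forall>F. adapted F g2_form \<longrightarrow> volume = (\<lambda>xs. - ewedge F [1,2,3,4,5,6,7] xs)"
  proof (intro allI impI)
    fix F assume F: "adapted F g2_form"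
    interpret F: basis7 F using adapted_form_eq[OF F] by blast
    interpret two_bases E F ..
    have "F.volume = volume" using volume_eq adapted_form_eq[OF F] by simp
    then show "volume = (\<lambda>xs. - ewedge F [1,2,3,4,5,6,7] xs)" using F.volume_def by (metis ext)
  qed
  show "\<omega> = volume" if "\<forall>F. adapted F g2_form \<longrightarrow> \<omega> = (\<lambda>xs. - ewedge F [1,2,3,4,5,6,7] xs)" for \<omega>
    using that adapted_self volume_def by (metis ext)
qed

lemma g2_structure_g2_form: "g2_structure g2_form"
  using adapted_self g2_structure_def by blast

lemma Phi_I_eq: "Phi_I g2_form S [a, b, c] = metric S S * g2_form [a, b, c]
    - metric S a * g2_form [S, b, c] + metric S b * g2_form [S, a, c] - metric S c * g2_form [S, a, b]"
  by (simp add: Phi_I_def g2_metric_g2_form flat_def interior_product_def one_form_wedge_Cons one_form_wedge_Nil)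

lemma Phi_J_eq: "Phi_J g2_form S [a, b, c] = psi S a b c"
  by (simp add: Phi_J_def g2_star_def g2_metric_g2_form g2_volume_g2_form hodge_star_g2_form
      interior_product_def psi_form_def)

lemma kform_Phi_I: "kform 3 (Phi_I g2_form S)"
proof -
  have "linear (metric S)" using bilinear_metric by (simp add: bilinear_def)
  then show ?thesis
    unfolding Phi_I_def g2_metric_g2_form flat_def
    by (intro kform_interior_product kform_one_form_wedge kform_g2_form)
qed

lemma kform_Phi_J: "kform 3 (Phi_J g2_form S)"
  using kform_interior_product[of 3 psi_form S] kform_psi_form
  by (simp add: Phi_J_def g2_star_def g2_metric_g2_form g2_volume_g2_form hodge_star_g2_form)

definition deform :: "'v \<Rightarrow> real \<Rightarrow> real \<Rightarrow> 'v form" where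
  "deform S A B xs = g2_form xs + A * Phi_I g2_form S xs + B * Phi_J g2_form S xs"

lemma kform_deform: "kform 3 (deform S A B)"
  unfolding deform_def[abs_def] by (intro kform_add kform_scale kform_g2_form kform_Phi_I kform_Phi_J)

lemma spin_form_deform:
  assumes "N = r\<^sup>2 + l\<^sup>2 * metric S S" "N \<noteq> 0"
  shows "spin_form (r, l *\<^sub>R S) a b c = deform S (- 2 * l\<^sup>2 / N) (- 2 * r * l / N) [a, b, c]"
proof -
  have N: "spinor_ip (r, l *\<^sub>R S) (r, l *\<^sub>R S) = N"
    using assms by (simp add: spinor_ip_def H_simps power2_eq_square)
  have "psi (l *\<^sub>R S) a b c = l * psi S a b c" by (simp add: psi_def H_simps cr_simps algebra_simps)
  then show ?thesis
    using spin_form_expand[of r "l *\<^sub>R S" a b c] assms(2) unfolding N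
    by (simp add: deform_def Phi_I_eq Phi_J_eq g2_form_cross H_simps cr_simps power2_eq_square field_simps)
qed

lemma is_basis7_image:
  assumes "linear h" "bij h" shows "is_basis7 (\<lambda>a. h (E a))"
proof -
  have im: "(\<lambda>a. h (E a)) ` {1..7} = h ` E ` {1..7}" by auto
  have "inj h" "surj h" using assms(2) by (auto simp: bij_def)
  then show ?thesis
    using is_basis linear_independent_injective_image[OF assms(1) indep] linear_span_image[OF assms(1)]
    unfolding is_basis7_def im by (auto simp: inj_on_def)
qed

text \<open>As \<open>x\<close> is orthogonal to \<open>v\<close>, the spinor
  \<open>cliff x (r, v)\<close> is a pure vector \<open>y\<close>, so it is also
  \<open>cliff y (1, 0)\<close>. The two signs of \<open>spin_form_reflect\<close> cancel, and the
  form of \<open>(r, v)\<close> is the pullback of the 3-form under the reflections in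
  \<open>x\<close> and then \<open>y\<close>.\<close>

lemma g2_structure_spin_form:
  assumes S: "metric x v = 0" "metric x x \<noteq> 0" and q: "spinor_ip (r, v) (r, v) \<noteq> 0"
  obtains F where "basis7 F" "basis7.metric F = metric" "basis7.volume F = volume"
    "\<And>a b c. basis7.g2_form F [a, b, c] = spin_form (r, v) a b c"
proof -
  define y where "y = r *\<^sub>R x + cross x v"
  have y: "cliff x (r, v) = cliff y (1, 0)" using S(1) by (simp add: cliff_def y_def H_simps cr_simps)
  have "metric y y = spinor_ip (cliff y (1, 0)) (cliff y (1, 0))"
    by (simp add: ip_cliff_cliff) (simp add: spinor_ip_def H_simps)
  also have "\<dots> = metric x x * spinor_ip (r, v) (r, v)" by (simp only: y[symmetric] ip_cliff_cliff)
  finally have "metric y y \<noteq> 0" using S(2) q by simp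
  note rr = reflect_reflect[OF this] reflect_reflect[OF S(2)] and yy = this
  define F where "F = (\<lambda>a. reflect x (reflect y (E a)))"
  let ?g = "\<lambda>a. reflect y (reflect x a)"
  have lin: "linear (\<lambda>a. reflect s (reflect t a))" for s t
    using linear_compose[OF linear_reflect linear_reflect] by (simp add: o_def)
  have "bij (\<lambda>a. reflect x (reflect y a))" by (rule bij_betw_byWitness[of _ ?g]) (auto simp: rr)
  then have "is_basis7 F" unfolding F_def by (intro is_basis7_image lin)
  then interpret F: basis7 F by (rule basis7.intro)
  interpret two_bases E F ..
  have g: "?g (F a) = E a" for a by (simp add: F_def rr)
  note ch = metric_change[OF lin g] volume_change[OF lin g] g2_form_change[OF lin g]
  have "F.metric a b = metric a b" for a b
    using ch(1) orthogonal_reflect[OF S(2)] orthogonal_reflect[OF yy] unfolding orthogonal_map_def by metis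
  moreover have "F.volume xs = volume xs" for xs
    using ch(2)[of xs] kform7_reflect[OF kform_volume yy, of "map (reflect x) xs"]
      kform7_reflect[OF kform_volume S(2), of xs] by (simp add: o_def)
  moreover have "F.g2_form [a, b, c] = spin_form (r, v) a b c" for a b c
  proof -
    have "F.g2_form [a, b, c] = spin_form (1, 0) (?g a) (?g b) (?g c)"
      using ch(3)[of "[a, b, c]"] by (simp add: spin_form_one g2_form_cross)
    also have "\<dots> = - spin_form (cliff x (r, v)) (reflect x a) (reflect x b) (reflect x c)"
      by (simp add: spin_form_reflect[OF yy] y)
    also have "\<dots> = spin_form (r, v) a b c"
      using spin_form_reflect[OF S(2), of "(r, v)" "reflect x a" "reflect x b" "reflect x c"] by (simp add: rr)
    finally show ?thesis .
  qed
  ultimately show thesis using that[of F] F.basis7_axioms by (simp add: fun_eq_iff)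
qed

text \<open>The spinor \<open>(B, A *\<^sub>R S)\<close> realises the point \<open>(A, B)\<close> of
  the conic. The point \<open>A = 0\<close>, where also \<open>B = 0\<close>, gives the undeformed
  form and is treated separately, as this spinor is then zero.\<close>

lemma deform_compatible:
  assumes S: "S \<noteq> 0" and eq: "metric S S * A\<^sup>2 + 2 * A + B\<^sup>2 = 0"
  shows "g2_structure (deform S A B) \<and> g2_metric (deform S A B) = metric \<and>
    g2_volume (deform S A B) = volume"
proof (cases "A = 0")
  case True
  then have "deform S A B = g2_form" using eq by (simp add: deform_def fun_eq_iff)
  then show ?thesis by (simp add: g2_structure_g2_form g2_metric_g2_form g2_volume_g2_form)
next
  case False
  obtain x where x: "metric x S = 0" "metric x x \<noteq> 0"
    using exists_nonnull_orthogonal[OF _ S] dim_UNIV by auto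
  \<comment> \<open>The conic equation says that the norm of the spinor is \<open>- 2 * A\<close>,
    so the parameters in \<open>spin_form_deform\<close> come out as \<open>A\<close> and
    \<open>B\<close>.\<close>
  have N: "- 2 * A = B\<^sup>2 + A\<^sup>2 * metric S S" using eq by (simp add: algebra_simps)
  have "spinor_ip (B, A *\<^sub>R S) (B, A *\<^sub>R S) \<noteq> 0"
    using N False by (simp add: spinor_ip_def H_simps power2_eq_square)
  moreover have "metric x (A *\<^sub>R S) = 0" using x by (simp add: H_simps)
  ultimately obtain F where F: "basis7 F" "basis7.metric F = metric" "basis7.volume F = volume"
    "\<And>a b c. basis7.g2_form F [a, b, c] = spin_form (B, A *\<^sub>R S) a b c"
    using g2_structure_spin_form x(2) by metis
  interpret F: basis7 F by fact
  have "F.g2_form = deform S A B"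
  proof (rule kform3_eqI[OF F.kform_g2_form kform_deform])
    show "F.g2_form [a, b, c] = deform S A B [a, b, c]" for a b c
      using F(4)[of a b c] spin_form_deform[OF N, of a b c] False by (simp add: power2_eq_square)
  qed
  then show ?thesis
    using F.g2_structure_g2_form F.g2_metric_g2_form F.g2_volume_g2_form F(2,3) by simp
qed

lemma exists_normalization: "\<exists>l S. v = l *\<^sub>R S \<and> metric S S \<in> {-1, 0, 1}"
proof (cases "metric v v = 0")
  case True
  \<comment> \<open>A null vector, including 0, needs no rescaling.\<close>
  then show ?thesis by (intro exI[of _ 1] exI[of _ v]) simp
next
  case False
  let ?l = "sqrt \<bar>metric v v\<bar>"
  have "metric ((1 / ?l) *\<^sub>R v) ((1 / ?l) *\<^sub>R v) = metric v v / \<bar>metric v v\<bar>"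
    by (simp add: H_simps)
  also have "\<dots> \<in> {-1, 0, 1}" using False by (auto simp: abs_if)
  finally show ?thesis using False by (intro exI[of _ ?l] exI[of _ "(1 / ?l) *\<^sub>R v"]) simp
qed

text \<open>The metric gives a spinor form up to sign, and the orientation excludes the sign -1.
  Writing the vector part of the spinor as \<open>l *\<^sub>R S\<close> with normalised
  \<open>S\<close> exhibits the deformation.\<close>

lemma compatible_deform:
  assumes "basis7 F" "basis7.metric F = metric" and c: "c > 0" "basis7.volume F = (\<lambda>xs. c * volume xs)"
  shows "\<exists>S A B. metric S S \<in> {-1, 0, 1} \<and> metric S S * A\<^sup>2 + 2 * A + B\<^sup>2 = 0 \<and>
    basis7.g2_form F = deform S A B"
proof -
  interpret F: basis7 F by fact
  interpret two_bases E F ..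
  obtain s q where s: "s \<in> {1, -1}" and q: "spinor_ip q q \<noteq> 0"
    and vol: "\<And>xs. F.volume xs = s * volume xs"
    and form: "\<And>a b c. F.g2_form [a, b, c] = s * spin_form q a b c"
    using spin_form_if_same_metric[OF assms(2)] by blast
  \<comment> \<open>Evaluated on the basis, where \<open>volume\<close> is -1.\<close>
  have "s = c" using vol[of "map E idx"] c(2) volume_E by simp
  then have "s = 1" using s c(1) by auto
  obtain r l S where rS: "q = (r, l *\<^sub>R S)" "metric S S \<in> {-1, 0, 1}"
    using exists_normalization by (metis prod.exhaust)
  define N where "N = r\<^sup>2 + l\<^sup>2 * metric S S"
  have N: "N \<noteq> 0" using q by (simp add: N_def rS spinor_ip_def H_simps power2_eq_square)
  have "F.g2_form = deform S (- 2 * l\<^sup>2 / N) (- 2 * r * l / N)"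
  proof (rule kform3_eqI[OF F.kform_g2_form kform_deform])
    show "F.g2_form [a, b, c] = deform S (- 2 * l\<^sup>2 / N) (- 2 * r * l / N) [a, b, c]" for a b c
      using form[of a b c] \<open>s = 1\<close> spin_form_deform[OF N_def N] rS by simp
  qed
  moreover have "metric S S * (- 2 * l\<^sup>2 / N)\<^sup>2 + 2 * (- 2 * l\<^sup>2 / N) + (- 2 * r * l / N)\<^sup>2
      = 4 * l\<^sup>2 * (l\<^sup>2 * metric S S - N + r\<^sup>2) / N\<^sup>2"
    using N by (simp add: power2_eq_square field_simps)
  then have "metric S S * (- 2 * l\<^sup>2 / N)\<^sup>2 + 2 * (- 2 * l\<^sup>2 / N) + (- 2 * r * l / N)\<^sup>2 = 0"
    by (simp add: N_def)
  ultimately show ?thesis using rS(2) by blast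
qed

end

lemma g2_structure_obtains_basis:
  assumes "g2_structure \<Phi>" obtains E where "basis7 E" "\<Phi> = basis7.g2_form E"
proof -
  obtain E where E: "adapted E \<Phi>" using assms g2_structure_def by blast
  then have "basis7 E" by (simp add: adapted_def basis7_def)
  then show thesis using that E basis7.adapted_g2_form by blast
qed

theorem proposition4p1:
  fixes \<Phi> :: "'v::real_vector form"
  assumes "dim (UNIV :: 'v set) = 7"
    and "g2_structure \<Phi>"
  shows "(\<forall>(S :: 'v) (\<epsilon> :: real) (A :: real) (B :: real).
            S \<noteq> 0 \<longrightarrow> \<epsilon> = - g2_metric \<Phi> S S \<longrightarrow> \<epsilon> \<in> {-1, 0, 1} \<longrightarrow>
            - \<epsilon> * A\<^sup>2 + 2 * A + B\<^sup>2 = 0 \<longrightarrow>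
            (let \<Phi>' = (\<lambda>xs. \<Phi> xs + A * Phi_I \<Phi> S xs + B * Phi_J \<Phi> S xs) in
               g2_structure \<Phi>' \<and>
               (g2_metric \<Phi>', orientation (g2_volume \<Phi>'))
                 = (g2_metric \<Phi>, orientation (g2_volume \<Phi>)))) \<and>
         (\<forall>\<Phi>' :: 'v form.
            g2_structure \<Phi>' \<longrightarrow>
            (g2_metric \<Phi>', orientation (g2_volume \<Phi>'))
              = (g2_metric \<Phi>, orientation (g2_volume \<Phi>)) \<longrightarrow>
            (\<exists>(S :: 'v) (\<epsilon> :: real) (A :: real) (B :: real).
               \<epsilon> = - g2_metric \<Phi> S S \<and> \<epsilon> \<in> {-1, 0, 1} \<and>
               - \<epsilon> * A\<^sup>2 + 2 * A + B\<^sup>2 = 0 \<and>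
               \<Phi>' = (\<lambda>xs. \<Phi> xs + A * Phi_I \<Phi> S xs + B * Phi_J \<Phi> S xs)))"
proof -
  obtain E where E: "basis7 E" "\<Phi> = basis7.g2_form E"
    using g2_structure_obtains_basis[OF assms(2)] .
  interpret basis7 E by fact
  note \<Phi> = E(2) g2_metric_g2_form g2_volume_g2_form
  have deform: "(\<lambda>xs. \<Phi> xs + A * Phi_I \<Phi> S xs + B * Phi_J \<Phi> S xs) = deform S A B" for S A B
    by (simp add: deform_def[abs_def] E(2))
  show ?thesis
    unfolding deform Let_def
  proof (intro conjI allI impI)
    fix S and \<epsilon> A B :: real
    assume "S \<noteq> 0" "\<epsilon> = - g2_metric \<Phi> S S" "- \<epsilon> * A\<^sup>2 + 2 * A + B\<^sup>2 = 0"
    then show "g2_structure (deform S A B)" and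
      "(g2_metric (deform S A B), orientation (g2_volume (deform S A B)))
        = (g2_metric \<Phi>, orientation (g2_volume \<Phi>))"
      using deform_compatible[of S A B] by (simp_all add: \<Phi>)
  next
    fix \<Phi>' :: "'v form"
    assume g2: "g2_structure \<Phi>'" and eq: "(g2_metric \<Phi>', orientation (g2_volume \<Phi>'))
        = (g2_metric \<Phi>, orientation (g2_volume \<Phi>))"
    obtain F where F: "basis7 F" "\<Phi>' = basis7.g2_form F"
      using g2_structure_obtains_basis[OF g2] .
    interpret F: basis7 F by fact
    have "F.metric = metric" "orientation F.volume = orientation volume"
      using eq by (simp_all add: \<Phi> F(2) F.g2_metric_g2_form F.g2_volume_g2_form)
    \<comment> \<open>Each volume form lies in its own orientation class; equality of the classes
      therefore yields a positive factor between the two volume forms.\<close>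
    moreover have "F.volume \<in> orientation F.volume"
      unfolding orientation_def by (auto intro: exI[of _ 1])
    ultimately obtain c where "c > 0" "F.volume = (\<lambda>xs. c * volume xs)"
      unfolding orientation_def by blast
    from compatible_deform[OF F(1) \<open>F.metric = metric\<close> this]
    obtain S A B where S: "metric S S \<in> {-1, 0, 1}" "metric S S * A\<^sup>2 + 2 * A + B\<^sup>2 = 0"
      "F.g2_form = deform S A B" by blast
    show "\<exists>S \<epsilon> A B. \<epsilon> = - g2_metric \<Phi> S S \<and> \<epsilon> \<in> {-1, 0, 1} \<and>
        - \<epsilon> * A\<^sup>2 + 2 * A + B\<^sup>2 = 0 \<and> \<Phi>' = deform S A B"
      \<comment> \<open>The set of admissible norms is closed under negation, so it also contains
        \<epsilon>.\<close>
      by (rule exI[of _ S], rule exI[of _ "- metric S S"], rule exI[of _ A], rule exI[of _ B])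
        (use S F(2) in \<open>auto simp: \<Phi>\<close>)
  qed
qed

end
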